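(* Let $B\subset A$ be an inclusion of simple unital $C^*$-algebras admitting a conditional expectation $A\to B$ of finite index, and let $B\subset A\subset A_1\subset A_2\subset\cdots$ be its tower of $C^*$-basic constructions (with $A_0=A$). Then $$\dim_{\mathbb{C}}(B'\cap A_k)\leq [A:B]_0^{\,k+1}\qquad\text{for all }k\geq 0.$$
   Context: Inclusions of unital $C^*$-algebras have common identity. A conditional expectation $E:A\to B$ is a positive norm-one projection onto $B$ with $E(axb)=aE(x)b$ for $a,b\in B$, $x\in A$. It has finite index if there is a finite set $\{\lambda_i\}\subset A$ (a quasi-basis) with $x=\sum_i\lambda_iE(\lambda_i^*x)=\sum_iE(x\lambda_i)\lambda_i^*$ for all $x\in A$; then $\mathrm{Ind}(E)=\sum_i\lambda_i\lambda_i^*$, independent of the quasi-basis. If $A,B$ are simple unital and a finite-index conditional expectation exists, all finite-index ones have scalar index and there is a unique one $E_0=E^A_B$ of minimal index; $[A:B]_0:=\mathrm{Ind}(E^A_B)$. Basic construction: $A$ is a Hilbert $B$-module with $\langle x,y\rangle_B=E_0(x^*y)$; $A$ acts by left multiplication; $e_1$ is the projection $x\mapsto E_0(x)$; $A_1$ is the $C^*$-algebra of adjointable $B$-linear maps on $A$ generated by $A$ and $e_1$. It is simple and unital, with minimal (dual) conditional expectation $E_1:A_1\to A$, $E_1(xe_1y)=[A:B]_0^{-1}xy$ for $x,y\in A$. Iterating (each time with respect to the minimal conditional expectation) gives the tower $B\subset A\subset A_1\subset A_2\subset\cdots$. $B'\cap A_k=\{x\in A_k: xb=bx\ \forall b\in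 B\}$. *)

theory Defs
  imports "HOL-Analysis.Analysis" "HOL-Library.FuncSet"
begin

section \<open>Unital C*-algebras\<close>

text \<open>The superclasses provide a complete algebra norm with \<open>norm 1 = 1\<close>, so that every
  algebra of this class is nonzero.\<close>

class cstar_algebra = real_normed_algebra_1 + banach +
  fixes scaleC :: "complex \<Rightarrow> 'a \<Rightarrow> 'a"  (infixr "*\<^sub>C" 75)
    and star :: "'a \<Rightarrow> 'a"
  assumes scaleC_add_right: "a *\<^sub>C (x + y) = a *\<^sub>C x + a *\<^sub>C y"
    and scaleC_add_left: "(a + b) *\<^sub>C x = a *\<^sub>C x + b *\<^sub>C x"
    and scaleC_scaleC: "a *\<^sub>C b *\<^sub>C x = (a * b) *\<^sub>C x"
    and scaleC_one: "1 *\<^sub>C x = x"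
    and scaleR_scaleC: "r *\<^sub>R x = complex_of_real r *\<^sub>C x"
    and mult_scaleC_left: "(a *\<^sub>C x) * y = a *\<^sub>C (x * y)"
    and mult_scaleC_right: "x * (a *\<^sub>C y) = a *\<^sub>C (x * y)"
    and norm_scaleC: "norm (a *\<^sub>C x) = cmod a * norm x"
    and star_star: "star (star x) = x"
    and star_add: "star (x + y) = star x + star y"
    and star_mult: "star (x * y) = star y * star x"
    and star_scaleC: "star (a *\<^sub>C x) = cnj a *\<^sub>C star x"
    and cstar_identity: "norm (star x * x) = (norm x)\<^sup>2"

global_interpretation complex_vs: vector_space "scaleC :: complex \<Rightarrow> 'a \<Rightarrow> 'a::cstar_algebra"
  by unfold_locales (simp_all add: scaleC_add_right scaleC_add_left scaleC_scaleC scaleC_one)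

text \<open>\<open>complex_vs.dim\<close> is \<open>0\<close> on infinite-dimensional sets, so finite dimensionality has to be
  stated separately.\<close>

definition finite_dimC :: "'a::cstar_algebra set \<Rightarrow> bool" where
  "finite_dimC V \<longleftrightarrow> (\<exists>F. finite F \<and> V \<subseteq> complex_vs.span F)"

text \<open>All algebras are norm-closed *-subalgebras of an ambient unital C*-algebra (the type), with
  the same identity.\<close>

definition cstar_subalgebra :: "'a::cstar_algebra set \<Rightarrow> bool" where
  "cstar_subalgebra S \<longleftrightarrow>
     1 \<in> S \<and> (\<forall>x\<in>S. \<forall>y\<in>S. x + y \<in> S) \<and> (\<forall>x\<in>S. \<forall>y\<in>S. x * y \<in> S) \<and>
     (\<forall>c. \<forall>x\<in>S. c *\<^sub>C x \<in> S) \<and> (\<forall>x\<in>S. star x \<in> S) \<and> closed S"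

definition closed_ideal :: "'a::cstar_algebra set \<Rightarrow> 'a set \<Rightarrow> bool" where
  "closed_ideal S I \<longleftrightarrow>
     I \<subseteq> S \<and> 0 \<in> I \<and> (\<forall>x\<in>I. \<forall>y\<in>I. x + y \<in> I) \<and> (\<forall>c. \<forall>x\<in>I. c *\<^sub>C x \<in> I) \<and>
     (\<forall>s\<in>S. \<forall>x\<in>I. s * x \<in> I \<and> x * s \<in> I) \<and> closed I"

definition simple_cstar :: "'a::cstar_algebra set \<Rightarrow> bool" where
  "simple_cstar S \<longleftrightarrow> cstar_subalgebra S \<and> (\<forall>I. closed_ideal S I \<longrightarrow> I = {0} \<or> I = S)"

definition positive_in :: "'a::cstar_algebra set \<Rightarrow> 'a \<Rightarrow> bool" where
  "positive_in S x \<longleftrightarrow> (\<exists>y\<in>S. x = star y * y)"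

definition relative_commutant :: "'a::cstar_algebra set \<Rightarrow> 'a set \<Rightarrow> 'a set" where
  "relative_commutant B A = {x \<in> A. \<forall>b\<in>B. x * b = b * x}"


section \<open>Conditional expectations and index\<close>

text \<open>An expectation \<open>A \<rightarrow> B\<close> is a function on the ambient type of which only the values on \<open>A\<close>
  matter. Its norm is at least one because it fixes \<open>1 \<in> B\<close>.\<close>

definition conditional_expectation ::
    "'a::cstar_algebra set \<Rightarrow> 'a set \<Rightarrow> ('a \<Rightarrow> 'a) \<Rightarrow> bool" where
  "conditional_expectation A B E \<longleftrightarrow>
     (\<forall>x\<in>A. E x \<in> B) \<and> (\<forall>b\<in>B. E b = b) \<and>
     (\<forall>x\<in>A. \<forall>y\<in>A. E (x + y) = E x + E y) \<and> (\<forall>c. \<forall>x\<in>A. E (c *\<^sub>C x) = c *\<^sub>C E x) \<and>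
     (\<forall>x. positive_in A x \<longrightarrow> positive_in B (E x)) \<and>
     (\<forall>x\<in>A. norm (E x) \<le> norm x) \<and>
     (\<forall>a\<in>B. \<forall>b\<in>B. \<forall>x\<in>A. E (a * x * b) = a * E x * b)"

definition quasi_basis ::
    "'a::cstar_algebra set \<Rightarrow> ('a \<Rightarrow> 'a) \<Rightarrow> nat \<Rightarrow> (nat \<Rightarrow> 'a) \<Rightarrow> bool" where
  "quasi_basis A E n u \<longleftrightarrow>
     (\<forall>i<n. u i \<in> A) \<and>
     (\<forall>x\<in>A. x = (\<Sum>i<n. u i * E (star (u i) * x)) \<and>
            x = (\<Sum>i<n. E (x * u i) * star (u i)))"

definition finite_index_expectation ::
    "'a::cstar_algebra set \<Rightarrow> 'a set \<Rightarrow> ('a \<Rightarrow> 'a) \<Rightarrow> bool" where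
  "finite_index_expectation A B E \<longleftrightarrow>
     conditional_expectation A B E \<and> (\<exists>n u. quasi_basis A E n u)"

definition Ind :: "'a::cstar_algebra set \<Rightarrow> ('a \<Rightarrow> 'a) \<Rightarrow> 'a" where
  "Ind A E = (THE z. \<exists>n u. quasi_basis A E n u \<and> z = (\<Sum>i<n. u i * star (u i)))"

definition minimal_expectation ::
    "'a::cstar_algebra set \<Rightarrow> 'a set \<Rightarrow> ('a \<Rightarrow> 'a) \<Rightarrow> bool" where
  "minimal_expectation A B E \<longleftrightarrow>
     finite_index_expectation A B E \<and>
     (\<exists>r::real. Ind A E = of_real r \<and>
        (\<forall>F s. finite_index_expectation A B F \<and> Ind A F = of_real s \<longrightarrow> r \<le> s))"

definition minimal_index :: "'a::cstar_algebra set \<Rightarrow> 'a set \<Rightarrow> real" where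
  "minimal_index A B = (THE r. \<exists>E. minimal_expectation A B E \<and> Ind A E = of_real r)"


section \<open>The C*-basic construction\<close>

text \<open>\<open>A\<close> is a right Hilbert \<open>B\<close>-module with the \<open>B\<close>-valued inner product \<open>E (star x * y)\<close>.
  Operators on \<open>A\<close> are represented by functions that are \<open>undefined\<close> outside \<open>A\<close>, so that
  operators which agree on \<open>A\<close> are equal.\<close>

definition module_inner :: "('a::cstar_algebra \<Rightarrow> 'a) \<Rightarrow> 'a \<Rightarrow> 'a \<Rightarrow> 'a" where
  "module_inner E x y = E (star x * y)"

definition module_norm :: "('a::cstar_algebra \<Rightarrow> 'a) \<Rightarrow> 'a \<Rightarrow> real" where
  "module_norm E x = sqrt (norm (module_inner E x x))"

definition module_maps :: "'a::cstar_algebra set \<Rightarrow> 'a set \<Rightarrow> ('a \<Rightarrow> 'a) set" where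
  "module_maps B A =
     {T \<in> A \<rightarrow>\<^sub>E A. (\<forall>x\<in>A. \<forall>y\<in>A. T (x + y) = T x + T y) \<and>
        (\<forall>c. \<forall>x\<in>A. T (c *\<^sub>C x) = c *\<^sub>C T x) \<and> (\<forall>x\<in>A. \<forall>b\<in>B. T (x * b) = T x * b)}"

definition adjoint_pair ::
    "'a::cstar_algebra set \<Rightarrow> ('a \<Rightarrow> 'a) \<Rightarrow> ('a \<Rightarrow> 'a) \<Rightarrow> ('a \<Rightarrow> 'a) \<Rightarrow> bool" where
  "adjoint_pair A E T T' \<longleftrightarrow>
     (\<forall>x\<in>A. \<forall>y\<in>A. module_inner E (T x) y = module_inner E x (T' y))"

definition adjointable_maps ::
    "'a::cstar_algebra set \<Rightarrow> 'a set \<Rightarrow> ('a \<Rightarrow> 'a) \<Rightarrow> ('a \<Rightarrow> 'a) set" where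
  "adjointable_maps B A E =
     {T \<in> module_maps B A. \<exists>T'\<in>module_maps B A. adjoint_pair A E T T'}"

text \<open>The last clause says that the set is closed in the operator norm belonging to
  \<open>module_norm E\<close>.\<close>

definition operator_cstar_algebra ::
    "'a::cstar_algebra set \<Rightarrow> 'a set \<Rightarrow> ('a \<Rightarrow> 'a) \<Rightarrow> ('a \<Rightarrow> 'a) set \<Rightarrow> bool" where
  "operator_cstar_algebra B A E \<S> \<longleftrightarrow>
     \<S> \<subseteq> adjointable_maps B A E \<and>
     (\<forall>S\<in>\<S>. \<forall>T\<in>\<S>. (\<lambda>x\<in>A. S x + T x) \<in> \<S>) \<and>
     (\<forall>S\<in>\<S>. \<forall>T\<in>\<S>. compose A S T \<in> \<S>) \<and>
     (\<forall>c. \<forall>T\<in>\<S>. (\<lambda>x\<in>A. c *\<^sub>C T x) \<in> \<S>) \<and>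
     (\<forall>T\<in>\<S>. \<forall>T'\<in>module_maps B A. adjoint_pair A E T T' \<longrightarrow> T' \<in> \<S>) \<and>
     (\<forall>T\<in>adjointable_maps B A E.
        (\<forall>\<epsilon>>0. \<exists>S\<in>\<S>. \<forall>x\<in>A. module_norm E (T x - S x) \<le> \<epsilon> * module_norm E x) \<longrightarrow> T \<in> \<S>)"

definition left_mult :: "'a::cstar_algebra set \<Rightarrow> 'a \<Rightarrow> 'a \<Rightarrow> 'a" where
  "left_mult A a = (\<lambda>x\<in>A. a * x)"

definition jones_projection :: "'a::cstar_algebra set \<Rightarrow> ('a \<Rightarrow> 'a) \<Rightarrow> 'a \<Rightarrow> 'a" where
  "jones_projection A E = (\<lambda>x\<in>A. E x)"

definition basic_construction_operators ::
    "'a::cstar_algebra set \<Rightarrow> 'a set \<Rightarrow> ('a \<Rightarrow> 'a) \<Rightarrow> ('a \<Rightarrow> 'a) set" where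
  "basic_construction_operators B A E =
     \<Inter> {\<S>. operator_cstar_algebra B A E \<S> \<and> left_mult A ` A \<subseteq> \<S> \<and> jones_projection A E \<in> \<S>}"

text \<open>The operators on \<open>A\<close> have a different type than the elements of \<open>A\<close>. To iterate the
  construction, \<open>A1 \<supseteq> A\<close> is taken to be any realization of the operator algebra in the ambient
  algebra: a *-isomorphic copy in which each \<open>a \<in> A\<close> is identified with left multiplication
  by \<open>a\<close>.\<close>

definition is_basic_construction ::
    "'a::cstar_algebra set \<Rightarrow> 'a set \<Rightarrow> ('a \<Rightarrow> 'a) \<Rightarrow> 'a set \<Rightarrow> bool" where
  "is_basic_construction B A E A1 \<longleftrightarrow>
     cstar_subalgebra A1 \<and> A \<subseteq> A1 \<and>
     (\<exists>\<pi>. bij_betw \<pi> A1 (basic_construction_operators B A E) \<and>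
        (\<forall>x\<in>A1. \<forall>y\<in>A1. \<pi> (x + y) = (\<lambda>z\<in>A. \<pi> x z + \<pi> y z)) \<and>
        (\<forall>x\<in>A1. \<forall>y\<in>A1. \<pi> (x * y) = compose A (\<pi> x) (\<pi> y)) \<and>
        (\<forall>c. \<forall>x\<in>A1. \<pi> (c *\<^sub>C x) = (\<lambda>z\<in>A. c *\<^sub>C \<pi> x z)) \<and>
        (\<forall>x\<in>A1. adjoint_pair A E (\<pi> x) (\<pi> (star x))) \<and>
        (\<forall>a\<in>A. \<pi> a = left_mult A a))"

text \<open>\<open>T k\<close> is the algebra \<open>A\<^sub>k\<close>; the algebra below it is \<open>below B T k\<close>, with
  \<open>A\<^sub>-\<^sub>1 = B\<close>.\<close>

definition below :: "'a set \<Rightarrow> (nat \<Rightarrow> 'a set) \<Rightarrow> nat \<Rightarrow> 'a set" where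
  "below B T k = (case k of 0 \<Rightarrow> B | Suc j \<Rightarrow> T j)"

definition basic_construction_tower ::
    "'a::cstar_algebra set \<Rightarrow> 'a set \<Rightarrow> (nat \<Rightarrow> 'a set) \<Rightarrow> bool" where
  "basic_construction_tower B A T \<longleftrightarrow>
     T 0 = A \<and>
     (\<exists>E. \<forall>k. minimal_expectation (T k) (below B T k) (E k) \<and>
              is_basic_construction (below B T k) (T k) (E k) (T (Suc k)))"

end

theory Submission
  imports Defs
begin

text \<open>
  The bound rests on an inequality for a single inclusion \<open>B \<subseteq> A\<close> with \<open>B\<close> simple: if a conditional
  expectation \<open>E\<close> has a quasi-basis \<open>u\<close> and scalar index \<open>\<Sum>j. u j * star (u j) = r\<close>, then the relative
  commutant \<open>M\<close> has dimension at most \<open>r\<close> (\<open>dim_relative_commutant_le\<close>). On \<open>M\<close> the expectation takes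
  values in the centre of \<open>B\<close>, which is \<open>\<complex>\<close> (\<open>simple_center\<close>), so \<open>\<phi> = E\<close> is a faithful state on \<open>M\<close>.
  For vectors \<open>m\<close> that are orthonormal with respect to \<open>\<phi> (star x * y)\<close>, Bessel's inequality in the
  \<open>B\<close>-module \<open>A\<close> says that \<open>\<Sum>m. m * star m \<le> r\<close> (\<open>bessel\<close>), hence \<open>\<Sum>m. \<phi> (m * star m) \<le> r\<close>. If their
  span is star-closed, the left side is at least the number of vectors: it is the squared
  Hilbert-Schmidt norm of the matrix \<open>S\<close> of the involution, and \<open>S\<close> times its complex conjugate is the
  identity (\<open>card_orthonormal_le_index\<close>).

  It remains to find an expectation from the \<open>k\<close>-th algebra of the tower onto \<open>B\<close> of index at most
  \<open>minimal_index A B ^ (k + 1)\<close>. Indices multiply under composition (\<open>index_compose\<close>), so it suffices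
  that the minimal index does not grow along the tower. On each basic construction the operator
  \<open>x = \<Sum>k. x (u k) * e * star (u k)\<close> has a dual expectation \<open>(1 / r) * \<Sum>k. x (u k) * star (u k)\<close>, which
  is again of finite index, with the same index \<open>r\<close> (\<open>dual_expectation\<close>); by minimality the next
  index is at most \<open>r\<close>.

  The order arguments need that the elements \<open>star y * y\<close> are closed under addition and that the norm is
  monotone on them. This is derived from scratch: square roots come from the binomial series, and
  \<open>cpos_star_mult_self\<close> identifies \<open>star y * y\<close> with the square of a self-adjoint element.
\<close>

section \<open>Elementary facts on C*-algebras\<close>

lemma star_0 [simp]: "star (0::'a::cstar_algebra) = 0"
  using star_add[of "0::'a" 0] by simp

lemma star_uminus: "star (- x) = - star (x::'a::cstar_algebra)"
  using star_add[of x "-x"] by (simp add: eq_neg_iff_add_eq_0 add.commute)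

lemma star_diff: "star (x - y) = star x - star (y::'a::cstar_algebra)"
  using star_add[of x "-y"] by (simp add: star_uminus)

lemma star_1 [simp]: "star (1::'a::cstar_algebra) = 1"
  using star_mult[of "1::'a" "star 1"] by (simp add: star_star)

lemma star_scaleR: "star (r *\<^sub>R x) = r *\<^sub>R star (x::'a::cstar_algebra)"
  by (simp add: scaleR_scaleC star_scaleC)

lemma star_of_real [simp]: "star (of_real r) = (of_real r :: 'a::cstar_algebra)"
  by (simp add: of_real_def star_scaleR)

lemma star_sum: "star (sum f I) = (\<Sum>i\<in>I. star (f i :: 'a::cstar_algebra))"
  by (induction I rule: infinite_finite_induct) (simp_all add: star_add)

lemma star_power: "star (x ^ n) = star (x::'a::cstar_algebra) ^ n"
  by (induction n) (simp_all add: star_mult power_commutes)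

lemma norm_star [simp]: "norm (star x) = norm (x::'a::cstar_algebra)"
proof -
  have le: "norm y \<le> norm (star y)" for y :: 'a
  proof (cases "y = 0")
    case False
    have "(norm y)\<^sup>2 \<le> norm (star y) * norm y"
      using cstar_identity[of y] norm_mult_ineq[of "star y" y] by simp
    with False show ?thesis by (simp add: power2_eq_square)
  qed simp
  show ?thesis using le[of x] le[of "star x"] by (simp add: star_star)
qed

lemma norm_selfadjoint_square: "star s = s \<Longrightarrow> norm (s * s) = (norm (s::'a::cstar_algebra))\<^sup>2"
  using cstar_identity[of s] by simp

lemma bounded_linear_star: "bounded_linear (star :: 'a::cstar_algebra \<Rightarrow> 'a)"
  by (rule bounded_linear_intro[where K = 1]) (simp_all add: star_add star_scaleR)

lemma of_real_scaleC: "(of_real r :: 'a::cstar_algebra) = complex_of_real r *\<^sub>C 1"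
  by (simp add: of_real_def scaleR_scaleC)

lemma scaleC_zero [simp]: "0 *\<^sub>C (x::'a::cstar_algebra) = 0"
  by (rule complex_vs.scale_zero_left)

context
  fixes S :: "'a::cstar_algebra set"
  assumes S: "cstar_subalgebra S"
begin

lemma subalg_1: "1 \<in> S" and subalg_add: "x \<in> S \<Longrightarrow> y \<in> S \<Longrightarrow> x + y \<in> S"
  and subalg_mult: "x \<in> S \<Longrightarrow> y \<in> S \<Longrightarrow> x * y \<in> S" and subalg_scaleC: "x \<in> S \<Longrightarrow> c *\<^sub>C x \<in> S"
  and subalg_star: "x \<in> S \<Longrightarrow> star x \<in> S" and subalg_closed: "closed S"
  using S by (auto simp: cstar_subalgebra_def)

lemma subalg_0: "0 \<in> S"
  using subalg_scaleC[OF subalg_1, of 0] by simp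

lemma subalg_scaleR: "x \<in> S \<Longrightarrow> r *\<^sub>R x \<in> S"
  by (simp add: scaleR_scaleC subalg_scaleC)

lemma subalg_uminus: "x \<in> S \<Longrightarrow> - x \<in> S"
  using subalg_scaleR[of x "-1"] by simp

lemma subalg_diff: "x \<in> S \<Longrightarrow> y \<in> S \<Longrightarrow> x - y \<in> S"
  using subalg_add[OF _ subalg_uminus, of x y] by simp

lemma subalg_of_real: "of_real r \<in> S"
  by (simp add: of_real_def subalg_scaleR subalg_1)

lemma subalg_sum: "(\<And>i. i \<in> I \<Longrightarrow> f i \<in> S) \<Longrightarrow> sum f I \<in> S"
  by (induction I rule: infinite_finite_induct) (simp_all add: subalg_0 subalg_add)

lemma subalg_power: "x \<in> S \<Longrightarrow> x ^ n \<in> S"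
  by (induction n) (simp_all add: subalg_1 subalg_mult)

end

section \<open>Square roots of positive elements\<close>

text \<open>The Taylor coefficients of \<open>sqrt (1 - t)\<close>. All of them after the first are nonpositive and the
  partial sums of the whole sequence stay nonnegative; so the series converges absolutely on the
  closed unit ball, and \<open>1 - sqrt (1 - b)\<close> has norm at most \<open>1\<close> there.\<close>

definition sqrt_coeff :: "nat \<Rightarrow> real" where
  "sqrt_coeff n = pochhammer (- 1 / 2) n / fact n"

lemma sqrt_coeff_gbinomial: "sqrt_coeff n = (- 1) ^ n * ((1 / 2) gchoose n)"
  by (simp add: sqrt_coeff_def gbinomial_pochhammer flip: power_mult_distrib)

lemma sqrt_coeff_0 [simp]: "sqrt_coeff 0 = 1"
  by (simp add: sqrt_coeff_def)

lemma sqrt_coeff_Suc_nonpos: "sqrt_coeff (Suc n) \<le> 0"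
proof -
  have "pochhammer (1 / 2 :: real) n \<ge> 0"
    by (rule pochhammer_nonneg) simp
  then show ?thesis
    by (simp add: sqrt_coeff_def pochhammer_rec divide_le_0_iff)
qed

lemma sum_sqrt_coeff: "(\<Sum>k\<le>n. sqrt_coeff k) = pochhammer (1 / 2) n / fact n"
proof -
  have "(\<Sum>k\<le>n. sqrt_coeff k) = (\<Sum>k\<le>n. ((1 / 2) gchoose k) * (- 1) ^ k)"
    by (simp add: sqrt_coeff_gbinomial mult.commute)
  also have "\<dots> = (- 1) ^ n * ((1 / 2 - 1) gchoose n)"
    by (rule gbinomial_sum_lower_neg)
  also have "\<dots> = pochhammer (1 / 2) n / fact n"
    by (simp add: gbinomial_pochhammer flip: power_mult_distrib)
  finally show ?thesis .
qed

lemma sum_sqrt_coeff_Suc_le: "(\<Sum>k<n. \<bar>sqrt_coeff (Suc k)\<bar>) \<le> 1"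
proof -
  have "(\<Sum>k<n. \<bar>sqrt_coeff (Suc k)\<bar>) = - (\<Sum>k<n. sqrt_coeff (Suc k))"
    by (simp add: sqrt_coeff_Suc_nonpos abs_of_nonpos sum_negf)
  also have "\<dots> = 1 - (\<Sum>k\<le>n. sqrt_coeff k)"
    by (simp add: lessThan_Suc_atMost[symmetric] sum.lessThan_Suc_shift del: sum.lessThan_Suc)
  also have "\<dots> \<le> 1"
    by (simp add: sum_sqrt_coeff pochhammer_nonneg)
  finally show ?thesis .
qed

lemma summable_sqrt_coeff: "summable (\<lambda>n. \<bar>sqrt_coeff n\<bar>)"
proof -
  have "summable (\<lambda>n. \<bar>sqrt_coeff (Suc n)\<bar>)"
    by (rule summableI_nonneg_bounded[where x = 1]) (simp_all add: sum_sqrt_coeff_Suc_le)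
  then show ?thesis using summable_Suc_iff[of "\<lambda>n. \<bar>sqrt_coeff n\<bar>"] by simp
qed

text \<open>Vandermonde's identity for the exponents \<open>1/2 + 1/2 = 1\<close>: the square of the series is \<open>1 - b\<close>.\<close>

lemma sqrt_coeff_convolution:
  "(\<Sum>i\<le>n. sqrt_coeff i * sqrt_coeff (n - i)) = (if n = 0 then 1 else if n = 1 then - 1 else 0)"
proof -
  have "(\<Sum>i\<le>n. sqrt_coeff i * sqrt_coeff (n - i))
      = (\<Sum>i\<le>n. (- 1) ^ n * (((1 / 2) gchoose i) * ((1 / 2) gchoose (n - i))))"
  proof (rule sum.cong)
    fix i assume "i \<in> {..n}"
    then have "(- 1) ^ n = (- 1) ^ i * (- 1 :: real) ^ (n - i)"
      by (simp flip: power_add)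
    then show "sqrt_coeff i * sqrt_coeff (n - i) = (- 1) ^ n * (((1 / 2) gchoose i) * ((1 / 2) gchoose (n - i)))"
      by (simp add: sqrt_coeff_gbinomial)
  qed simp
  also have "\<dots> = (- 1) ^ n * ((1 / 2 + 1 / 2 :: real) gchoose n)"
    by (simp only: gbinomial_Vandermonde sum_distrib_left[symmetric] atLeast0AtMost[symmetric])
  also have "(1 / 2 + 1 / 2 :: real) gchoose n = of_nat (1 choose n)"
    by (simp add: binomial_gbinomial)
  finally show ?thesis
    by (cases n) (auto simp: binomial_eq_0)
qed

definition binomial_sqrt :: "'a::cstar_algebra \<Rightarrow> 'a" where
  "binomial_sqrt b = (\<Sum>n. sqrt_coeff n *\<^sub>R b ^ n)"

context
  fixes b :: "'a::cstar_algebra"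
  assumes b: "norm b \<le> 1"
begin

lemma norm_sqrt_term_le: "norm (sqrt_coeff n *\<^sub>R b ^ n) \<le> \<bar>sqrt_coeff n\<bar>"
proof -
  have "norm (b ^ n) \<le> 1"
    using norm_power_ineq[of b n] power_le_one[OF norm_ge_zero b, of n] by linarith
  then show ?thesis by (simp add: mult_left_le)
qed

lemma summable_norm_sqrt: "summable (\<lambda>n. norm (sqrt_coeff n *\<^sub>R b ^ n))"
  by (rule summable_comparison_test[OF _ summable_sqrt_coeff]) (use norm_sqrt_term_le in auto)

lemma summable_sqrt: "summable (\<lambda>n. sqrt_coeff n *\<^sub>R b ^ n)"
  by (rule summable_norm_cancel[OF summable_norm_sqrt])

lemma binomial_sqrt_square: "binomial_sqrt b * binomial_sqrt b = 1 - b"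
proof -
  let ?f = "\<lambda>n. (if n = 0 then 1 else if n = 1 then - 1 else 0 :: real) *\<^sub>R b ^ n"
  have "(\<Sum>i\<le>n. (sqrt_coeff i *\<^sub>R b ^ i) * (sqrt_coeff (n - i) *\<^sub>R b ^ (n - i))) = ?f n" for n
  proof -
    have "(\<Sum>i\<le>n. (sqrt_coeff i *\<^sub>R b ^ i) * (sqrt_coeff (n - i) *\<^sub>R b ^ (n - i)))
        = (\<Sum>i\<le>n. (sqrt_coeff i * sqrt_coeff (n - i)) *\<^sub>R b ^ n)"
      by (rule sum.cong) (simp_all flip: power_add)
    then show ?thesis
      by (simp only: scaleR_sum_left[symmetric] sqrt_coeff_convolution)
  qed
  then have "?f sums (binomial_sqrt b * binomial_sqrt b)"
    using Cauchy_product_sums[OF summable_norm_sqrt summable_norm_sqrt]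
    by (simp add: binomial_sqrt_def)
  moreover have "?f sums (\<Sum>n\<in>{0,1}. ?f n)"
    by (rule sums_finite) auto
  ultimately have "binomial_sqrt b * binomial_sqrt b = (\<Sum>n\<in>{0,1}. ?f n)"
    by (rule sums_unique2)
  then show ?thesis by simp
qed

lemma binomial_sqrt_in: "cstar_subalgebra S \<Longrightarrow> b \<in> S \<Longrightarrow> binomial_sqrt b \<in> S"
  unfolding binomial_sqrt_def
  by (rule closed_sequentially[OF subalg_closed _ summable_LIMSEQ[OF summable_sqrt]])
    (simp_all add: subalg_sum subalg_scaleR subalg_power)

lemma binomial_sqrt_commute: "z * b = b * z \<Longrightarrow> z * binomial_sqrt b = binomial_sqrt b * z"
proof -
  assume zb: "z * b = b * z"
  have "z * b ^ n = b ^ n * z" for n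
    by (induction n) (simp, metis zb mult.assoc power_Suc)
  then show ?thesis
    unfolding binomial_sqrt_def
    by (simp add: suminf_mult[OF summable_sqrt, symmetric] suminf_mult2[OF summable_sqrt])
qed

lemma binomial_sqrt_selfadjoint: "star b = b \<Longrightarrow> star (binomial_sqrt b) = binomial_sqrt b"
  unfolding binomial_sqrt_def
  by (simp add: bounded_linear.suminf[OF bounded_linear_star summable_sqrt] star_scaleR star_power)

lemma norm_one_minus_binomial_sqrt: "norm (1 - binomial_sqrt b) \<le> 1"
proof -
  let ?g = "\<lambda>n. sqrt_coeff n *\<^sub>R b ^ n"
  have t: "summable (\<lambda>n. norm (?g (Suc n)))"
    using summable_norm_sqrt summable_Suc_iff[of "\<lambda>n. norm (?g n)"] by blast
  have s: "summable (\<lambda>n. \<bar>sqrt_coeff (Suc n)\<bar>)"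
    using summable_sqrt_coeff summable_Suc_iff[of "\<lambda>n. \<bar>sqrt_coeff n\<bar>"] by simp
  have "1 - binomial_sqrt b = - (\<Sum>n. ?g (Suc n))"
    using suminf_split_head[OF summable_sqrt] by (simp add: binomial_sqrt_def)
  then have "norm (1 - binomial_sqrt b) = norm (\<Sum>n. ?g (Suc n))" by simp
  also have "\<dots> \<le> (\<Sum>n. norm (?g (Suc n)))"
    by (rule summable_norm[OF t])
  also have "\<dots> \<le> (\<Sum>n. \<bar>sqrt_coeff (Suc n)\<bar>)"
    by (intro suminf_le norm_sqrt_term_le s t)
  also have "\<dots> \<le> 1"
    by (rule suminf_le_const[OF s]) (rule sum_sqrt_coeff_Suc_le)
  finally show ?thesis .
qed

end

section \<open>Positive elements\<close>

text \<open>Squares of self-adjoint elements are easier to handle than the elements \<open>star y * y\<close>: they are exactly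
  the self-adjoint \<open>x\<close> with \<open>\<parallel>t - x\<parallel> \<le> t\<close> for some \<open>t\<close>, a condition that is stable under sums by the triangle inequality.
  That every \<open>star y * y\<close> is of this form is the harder fact \<open>cpos_star_mult_self\<close>.\<close>

definition cpos :: "'a::cstar_algebra \<Rightarrow> bool" where
  "cpos x \<longleftrightarrow> (\<exists>s. star s = s \<and> x = s * s)"

lemma cpos_square: "star s = s \<Longrightarrow> cpos (s * s)"
  by (auto simp: cpos_def)

lemma cpos_selfadjoint: "cpos x \<Longrightarrow> star x = x"
  by (auto simp: cpos_def star_mult)

lemma of_real_commute: "of_real r * x = x * (of_real r :: 'a::cstar_algebra)"
  by (simp add: of_real_def)

text \<open>If \<open>\<parallel>t - x\<parallel> \<le> t\<close> then \<open>x = t (1 - b)\<close> with \<open>\<parallel>b\<parallel> \<le> 1\<close>, and the binomial series gives a root. Being a limit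
  of polynomials in \<open>x\<close>, the root commutes with what commutes with \<open>x\<close> and stays in every
  C*-subalgebra; the norm estimate makes the root itself positive.\<close>

lemma sqrt_exists_of_norm:
  fixes x :: "'a::cstar_algebra"
  assumes x: "star x = x" and le: "norm (of_real t - x) \<le> t"
  shows "\<exists>s. star s = s \<and> s * s = x \<and> norm (of_real (sqrt t) - s) \<le> sqrt t \<and>
    (\<forall>z. z * x = x * z \<longrightarrow> z * s = s * z) \<and> (\<forall>S. cstar_subalgebra S \<and> x \<in> S \<longrightarrow> s \<in> S)"
proof (cases "t = 0")
  case True
  with le have "x = 0" by simp
  then show ?thesis using True by (intro exI[of _ 0]) (auto simp: subalg_0)
next
  case False
  then have t: "t > 0" using le norm_ge_zero[of "of_real t - x"] by linarith
  define b where "b = 1 - (1 / t) *\<^sub>R x"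
  have b_eq: "b = (1 / t) *\<^sub>R (of_real t - x)"
    using t by (simp add: b_def scaleR_diff_right of_real_def)
  have nb: "norm b \<le> 1"
    using le t by (simp add: b_eq)
  have sb: "star b = b" by (simp add: b_def star_diff star_scaleR x)
  define s where "s = sqrt t *\<^sub>R binomial_sqrt b"
  show ?thesis
  proof (intro exI conjI allI impI)
    show "star s = s"
      by (simp add: s_def star_scaleR binomial_sqrt_selfadjoint[OF nb sb])
    have "s * s = t *\<^sub>R (1 - b)"
      using t by (simp add: s_def binomial_sqrt_square[OF nb])
    then show "s * s = x" using t by (simp add: b_def)
    have "of_real (sqrt t) - s = sqrt t *\<^sub>R (1 - binomial_sqrt b)"
      by (simp add: s_def scaleR_diff_right of_real_def)
    then show "norm (of_real (sqrt t) - s) \<le> sqrt t"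
      using norm_one_minus_binomial_sqrt[OF nb] t by (simp add: mult_left_le)
    show "z * s = s * z" if "z * x = x * z" for z
    proof -
      have "z * b = b * z" by (simp add: b_def algebra_simps that)
      then show ?thesis by (simp add: s_def binomial_sqrt_commute[OF nb])
    qed
    show "s \<in> S" if *: "cstar_subalgebra S \<and> x \<in> S" for S
    proof -
      have S: "cstar_subalgebra S" and "x \<in> S" using * by auto
      have "b \<in> S" unfolding b_def
        by (intro subalg_diff[OF S] subalg_1[OF S] subalg_scaleR[OF S] \<open>x \<in> S\<close>)
      then show ?thesis unfolding s_def
        by (intro subalg_scaleR[OF S] binomial_sqrt_in[OF nb S])
    qed
  qed
qed

lemma cposI_norm: "star x = x \<Longrightarrow> norm (of_real t - x) \<le> t \<Longrightarrow> cpos x"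
  using sqrt_exists_of_norm[of x t] cpos_square by blast

text \<open>The element \<open>u = a + \<i> w\<close> satisfies \<open>star u * u = t\<close>, so it is a multiple of an isometry, and \<open>a\<close> is
  its real part.\<close>

lemma norm_square_le_of_sum_squares:
  fixes a w :: "'a::cstar_algebra"
  assumes sa: "star a = a" and sw: "star w = w" and aw: "a * w = w * a"
    and eq: "a * a + w * w = of_real t" and t: "0 \<le> t"
  shows "norm (a * a) \<le> t"
proof -
  define u where "u = a + \<i> *\<^sub>C w"
  have su: "star u = a - \<i> *\<^sub>C w"
    by (simp add: u_def star_add star_scaleC sa sw complex_vs.scale_minus_left)
  have "star u * u = a * a + w * w"
    by (simp add: su, simp add: u_def distrib_left left_diff_distrib mult_scaleC_left mult_scaleC_right
        complex_vs.scale_right_diff_distrib scaleC_scaleC scaleC_one aw)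
  then have "(norm u)\<^sup>2 = t"
    using cstar_identity[of u] eq t by simp
  moreover have "norm a \<le> norm u"
  proof -
    have "a = (1 / 2) *\<^sub>R (u + star u)"
      by (simp add: su, simp add: u_def flip: scaleR_add_left scaleR_2)
    then have "norm a = (1 / 2) * norm (u + star u)" by (metis norm_scaleR abs_of_nonneg zero_le_divide_1_iff zero_le_numeral)
    then show ?thesis using norm_triangle_ineq[of u "star u"] by simp
  qed
  ultimately show ?thesis
    using power_mono[of "norm a" "norm u" 2] by (simp add: norm_selfadjoint_square sa)
qed

text \<open>For \<open>x = a\<^sup>2\<close> the difference \<open>t - x\<close> is the square of a \<open>w\<close> commuting with \<open>a\<close>, and the
  previous lemma bounds \<open>w\<^sup>2\<close>.\<close>

lemma cpos_norm_diff_le: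
  fixes x :: "'a::cstar_algebra"
  assumes "cpos x" and t: "norm x \<le> t"
  shows "norm (of_real t - x) \<le> t"
proof (cases "t = 0")
  case False
  then have t0: "t > 0" using t norm_ge_zero[of x] by linarith
  obtain a where a: "star a = a" "x = a * a" using assms(1) by (auto simp: cpos_def)
  define b where "b = (1 / t) *\<^sub>R x"
  have nb: "norm b \<le> 1" using t t0 by (simp add: b_def)
  define w where "w = sqrt t *\<^sub>R binomial_sqrt b"
  have sb: "star b = b" by (simp add: b_def a star_scaleR star_mult)
  have ww: "w * w = of_real t - a * a"
  proof -
    have "w * w = t *\<^sub>R (1 - b)" using t0 by (simp add: w_def binomial_sqrt_square[OF nb])
    then show ?thesis using t0 by (simp add: b_def a scaleR_diff_right of_real_def)
  qed
  have "a * w = w * a"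
    using binomial_sqrt_commute[OF nb, of a] by (simp add: w_def b_def a mult.assoc)
  moreover have "star w = w"
    by (simp add: w_def star_scaleR binomial_sqrt_selfadjoint[OF nb sb])
  ultimately have "norm (w * w) \<le> t"
    by (intro norm_square_le_of_sum_squares[of w a t]) (use a(1) ww t0 in simp_all)
  then show ?thesis by (simp add: ww a)
qed (use t in simp)

lemma cpos_sqrt_exists:
  fixes x :: "'a::cstar_algebra"
  assumes "cpos x"
  shows "\<exists>s. cpos s \<and> s * s = x \<and> (\<forall>z. z * x = x * z \<longrightarrow> z * s = s * z) \<and>
    (\<forall>S. cstar_subalgebra S \<and> x \<in> S \<longrightarrow> s \<in> S)"
proof -
  obtain s where s: "star s = s" "norm (of_real (sqrt (norm x)) - s) \<le> sqrt (norm x)"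
    and "s * s = x \<and> (\<forall>z. z * x = x * z \<longrightarrow> z * s = s * z) \<and> (\<forall>S. cstar_subalgebra S \<and> x \<in> S \<longrightarrow> s \<in> S)"
    using sqrt_exists_of_norm[OF cpos_selfadjoint[OF assms] cpos_norm_diff_le[OF assms order_refl]]
    by blast
  then show ?thesis using cposI_norm[OF s] by blast
qed

lemma cpos_0 [simp]: "cpos 0"
  using cpos_square[of 0] by simp

lemma cpos_add: "cpos x \<Longrightarrow> cpos y \<Longrightarrow> cpos (x + y)"
proof -
  assume p: "cpos x" "cpos y"
  have "of_real (norm x + norm y) - (x + y) = (of_real (norm x) - x) + (of_real (norm y) - y)"
    by simp
  then have "norm (of_real (norm x + norm y) - (x + y)) \<le> norm x + norm y"
    using norm_triangle_mono[OF cpos_norm_diff_le[OF p(1) order_refl] cpos_norm_diff_le[OF p(2) order_refl]]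
    by (simp only:)
  then show ?thesis
    using p by (intro cposI_norm[of _ "norm x + norm y"]) (simp_all add: star_add cpos_selfadjoint)
qed

lemma cpos_sum: "(\<And>i. i \<in> I \<Longrightarrow> cpos (f i)) \<Longrightarrow> cpos (sum f I)"
  by (induction I rule: infinite_finite_induct) (simp_all add: cpos_add)

lemma cpos_scaleR: "cpos x \<Longrightarrow> 0 \<le> r \<Longrightarrow> cpos (r *\<^sub>R x)"
  using cpos_square[of "sqrt r *\<^sub>R s" for s] by (auto simp: cpos_def star_scaleR)

lemma cpos_of_real_iff: "cpos (of_real c :: 'a::cstar_algebra) \<longleftrightarrow> 0 \<le> c"
proof
  assume "cpos (of_real c :: 'a)"
  then have "norm (of_real \<bar>c\<bar> - of_real c :: 'a) \<le> \<bar>c\<bar>"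
    by (rule cpos_norm_diff_le) simp
  then show "0 \<le> c" by (simp flip: of_real_diff)
next
  assume "0 \<le> c"
  then show "cpos (of_real c :: 'a)"
    using cpos_square[of "of_real (sqrt c) :: 'a"] by (simp flip: of_real_mult)
qed

lemma cpos_norm_minus: "cpos x \<Longrightarrow> norm x \<le> t \<Longrightarrow> cpos (of_real t - x)"
  by (rule cposI_norm[of _ t]) (simp_all add: star_diff cpos_selfadjoint)

lemma norm_le_of_positive_diff:
  fixes x :: "'a::cstar_algebra"
  assumes "cpos x" "cpos (of_real t - x)" "0 \<le> t"
  shows "norm x \<le> t"
proof -
  obtain a where a: "cpos a" "a * a = x" using cpos_sqrt_exists[OF assms(1)] by blast
  obtain w where w: "cpos w" "w * w = of_real t - x"
    "\<And>z. z * (of_real t - x) = (of_real t - x) * z \<Longrightarrow> z * w = w * z"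
    using cpos_sqrt_exists[OF assms(2)] by blast
  have "a * w = w * a"
    by (rule w(3)) (simp add: algebra_simps of_real_commute flip: a(2))
  then have "norm (a * a) \<le> t"
    by (rule norm_square_le_of_sum_squares[OF cpos_selfadjoint[OF a(1)] cpos_selfadjoint[OF w(1)] _ _ assms(3)])
      (simp add: a(2) w(2))
  then show ?thesis by (simp only: a(2))
qed

lemma norm_mono_positive:
  assumes "cpos x" "cpos (y - x)"
  shows "norm x \<le> norm y"
proof (rule norm_le_of_positive_diff[OF assms(1)])
  have "cpos y" using cpos_add[OF assms] by simp
  then have "cpos ((of_real (norm y) - y) + (y - x))"
    by (intro cpos_add assms cpos_norm_minus) simp_all
  then show "cpos (of_real (norm y) - x)" by simp
qed simp

lemma cpos_add_eq_0: "cpos x \<Longrightarrow> cpos y \<Longrightarrow> x + y = 0 \<Longrightarrow> x = 0"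
proof -
  assume p: "cpos x" "cpos y" and eq: "x + y = 0"
  have "norm x \<le> norm (x + y)"
    by (rule norm_mono_positive[OF p(1)]) (simp add: p(2))
  then show "x = 0" by (simp only: eq norm_zero norm_le_zero_iff)
qed

lemma cartesian_decomposition:
  fixes w :: "'a::cstar_algebra"
  shows "\<exists>p q. star p = p \<and> star q = q \<and> w = p + \<i> *\<^sub>C q \<and> star w = p - \<i> *\<^sub>C q \<and>
    (\<forall>z. z * w = w * z \<and> z * star w = star w * z \<longrightarrow> z * p = p * z \<and> z * q = q * z) \<and>
    (\<forall>S. cstar_subalgebra S \<and> w \<in> S \<longrightarrow> p \<in> S \<and> q \<in> S)"
proof -
  define p where "p = (1 / 2) *\<^sub>C (w + star w)"
  define q where "q = (- \<i> / 2) *\<^sub>C (w - star w)"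
  have 1: "star p = p" by (simp add: p_def star_scaleC star_add star_star add.commute)
  have "star q = (\<i> / 2) *\<^sub>C (star w - w)" by (simp add: q_def star_scaleC star_diff star_star star_uminus)
  also have "\<dots> = (- (\<i> / 2)) *\<^sub>C (w - star w)"
    by (simp add: complex_vs.scale_right_diff_distrib)
  finally have 2: "star q = q" by (simp add: q_def)
  have iq: "\<i> *\<^sub>C q = (1 / 2) *\<^sub>C (w - star w)" by (simp add: q_def scaleC_scaleC)
  have half: "(1 / 2) *\<^sub>C x + (1 / 2) *\<^sub>C x = x" for x :: 'a
    by (simp add: scaleC_one flip: scaleC_add_left)
  have 3: "w = p + \<i> *\<^sub>C q"
    unfolding iq p_def by (simp add: half flip: scaleC_add_right) (simp add: scaleC_add_right half)
  have 4: "star w = p - \<i> *\<^sub>C q"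
    unfolding iq p_def
    by (simp flip: complex_vs.scale_right_diff_distrib) (simp add: scaleC_add_right half)
  have 5: "z * p = p * z \<and> z * q = q * z" if "z * w = w * z" "z * star w = star w * z" for z
    by (simp add: p_def q_def mult_scaleC_left mult_scaleC_right algebra_simps that)
  have 6: "p \<in> S \<and> q \<in> S" if S: "cstar_subalgebra S" "w \<in> S" for S
    unfolding p_def q_def
    by (intro conjI subalg_scaleC subalg_add subalg_diff subalg_star S)
  show ?thesis using 1 2 3 4 5 6 by blast
qed

text \<open>The algebraic core of the positivity of \<open>star y * y\<close>. Since \<open>star w * w + w * star w\<close> is a sum of
  self-adjoint squares, \<open>k = w * star w\<close> is positive while \<open>star w * w = -c\<^sup>2\<close> is negative, both of
  norm \<open>t = \<parallel>w\<parallel>\<^sup>2\<close>. Moving \<open>w\<close> through the polynomial gives \<open>(t + k)\<^sup>2 k = w (t - c\<^sup>2)\<^sup>2 star w\<close>. The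
  right side has norm at most \<open>t\<^sup>3\<close>, and the left side dominates \<open>2 t k\<^sup>2\<close>, of norm \<open>2 t\<^sup>3\<close>.\<close>

lemma star_mult_self_eq_neg_square:
  fixes w c :: "'a::cstar_algebra"
  assumes c: "star c = c" and eq: "star w * w = - (c * c)"
  shows "w = 0"
proof -
  define t where "t = (norm w)\<^sup>2"
  define k where "k = w * star w"
  let ?t = "of_real t :: 'a"
  obtain p q where pq: "star p = p" "star q = q" "w = p + \<i> *\<^sub>C q" "star w = p - \<i> *\<^sub>C q"
    using cartesian_decomposition[of w] by blast
  have "w * star w + star w * w = (p * p + p * p) + (q * q + q * q)"
    unfolding pq(4) unfolding pq(3)
    by (simp add: algebra_simps mult_scaleC_left mult_scaleC_right scaleC_scaleC
          complex_vs.scale_minus_left scaleC_add_right complex_vs.scale_right_diff_distrib scaleC_one)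
  then have k_eq: "k = (p * p + p * p) + (q * q + q * q) + c * c"
    by (simp add: k_def eq algebra_simps)
  have k: "cpos k"
    unfolding k_eq by (intro cpos_add cpos_square pq c)
  have t_nonneg: "0 \<le> t" by (simp add: t_def)
  have nk: "norm k = t"
    using cstar_identity[of "star w"] by (simp add: k_def t_def star_star)
  have nc: "norm (c * c) = t"
    using cstar_identity[of w] by (simp add: eq t_def)
  have kkk: "cpos (k * k * k)"
  proof -
    obtain s where s: "star s = s" "k = s * s" using k by (auto simp: cpos_def)
    have "cpos ((s * s * s) * (s * s * s))" by (rule cpos_square) (simp add: star_mult s mult.assoc)
    then show ?thesis by (simp add: s mult.assoc)
  qed
  have move: "w * (?t - c * c) = (?t + k) * w"
    by (simp add: k_def distrib_right distrib_left of_real_commute mult.assoc eq right_diff_distrib)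
  have "w * (?t - c * c) * (?t - c * c) * star w = (?t + k) * ((?t + k) * k)"
    by (metis move k_def mult.assoc)
  also have "\<dots> = (2 * t) *\<^sub>R (k * k) + (t\<^sup>2 *\<^sub>R k + k * k * k)"
    by (simp add: algebra_simps of_real_def power2_eq_square flip: scaleR_2)
  finally have poly: "w * (?t - c * c) * (?t - c * c) * star w = (2 * t) *\<^sub>R (k * k) + (t\<^sup>2 *\<^sub>R k + k * k * k)" .
  have "cpos ((2 * t) *\<^sub>R (k * k))"
    using t_nonneg k by (intro cpos_scaleR cpos_square cpos_selfadjoint) simp_all
  moreover have "cpos (t\<^sup>2 *\<^sub>R k + k * k * k)"
    using k kkk by (intro cpos_add cpos_scaleR) simp_all
  ultimately have "norm ((2 * t) *\<^sub>R (k * k)) \<le> norm (w * (?t - c * c) * (?t - c * c) * star w)"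
    unfolding poly by (intro norm_mono_positive) simp_all
  also have "\<dots> \<le> norm w * norm (?t - c * c) * norm (?t - c * c) * norm (star w)"
    by (intro order_trans[OF norm_mult_ineq] mult_right_mono norm_ge_zero order_refl)
  also have "\<dots> \<le> norm w * t * t * norm w"
  proof -
    have "norm (?t - c * c) \<le> t"
      by (rule cpos_norm_diff_le[OF cpos_square[OF c]]) (simp add: nc)
    then show ?thesis unfolding norm_star using t_nonneg
      by (intro mult_mono order_refl mult_nonneg_nonneg norm_ge_zero)
  qed
  finally have "2 * t * t\<^sup>2 \<le> t * t\<^sup>2"
    using t_nonneg nk k
    by (simp add: norm_selfadjoint_square cpos_selfadjoint) (simp add: t_def power2_eq_square mult_ac)
  then have "t = 0" using t_nonneg by (cases "t = 0") (simp_all add: mult_le_cancel_right)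
  then show ?thesis by (simp add: t_def)
qed

text \<open>Here \<open>k = |h|\<close>, \<open>b = (|h| - h)/2\<close> is the negative part of \<open>h\<close>, and \<open>r\<close> is a square root of \<open>|h|\<close>.
  The root serves to write \<open>b\<^sup>3 = |h| b\<^sup>2 = (r b)\<^sup>2\<close> as a square before \<open>b\<close> is known to be positive.\<close>

lemma negative_part:
  fixes h :: "'a::cstar_algebra"
  assumes h: "star h = h"
  shows "\<exists>k r b. cpos k \<and> star b = b \<and> b * h = - (b * b) \<and> b * b = k * b \<and>
    h = k - b - b \<and> star r = r \<and> r * b = b * r \<and> k = r * r \<and>
    (\<forall>z. z * h = h * z \<longrightarrow> z * b = b * z) \<and>
    (\<forall>S. cstar_subalgebra S \<and> h \<in> S \<longrightarrow> b \<in> S \<and> k \<in> S)"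
proof -
  obtain k where k: "cpos k" "k * k = h * h" "\<And>z. z * (h * h) = (h * h) * z \<Longrightarrow> z * k = k * z"
    "\<And>S. cstar_subalgebra S \<Longrightarrow> h * h \<in> S \<Longrightarrow> k \<in> S"
    using cpos_sqrt_exists[OF cpos_square[OF h]] by blast
  obtain r where r: "cpos r" "r * r = k" "\<And>z. z * k = k * z \<Longrightarrow> z * r = r * z"
    using cpos_sqrt_exists[OF k(1)] by blast
  have hk: "h * k = k * h" by (rule k(3)) (simp add: mult.assoc)
  have hr: "h * r = r * h" by (rule r(3)) (rule hk)
  have kr: "k * r = r * k" by (rule r(3)) (rule refl)
  define b where "b = (1 / 2) *\<^sub>R (k - h)"
  show ?thesis
  proof (intro exI conjI allI impI)
    show "cpos k" by (rule k(1))
    show "star b = b" by (simp add: b_def star_scaleR star_diff h cpos_selfadjoint k)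
    show "b * h = - (b * b)"
      by (simp add: b_def algebra_simps hk k(2) flip: scaleR_add_left)
    show "b * b = k * b"
      by (simp add: b_def algebra_simps hk k(2) flip: scaleR_add_left)
    show "h = k - b - b"
    proof -
      have "b + b = 2 *\<^sub>R b" by (simp add: scaleR_2)
      also have "\<dots> = k - h" by (simp add: b_def)
      finally show ?thesis by (simp add: algebra_simps)
    qed
    show "star r = r" by (rule cpos_selfadjoint[OF r(1)])
    show "r * b = b * r" by (simp add: b_def algebra_simps hr kr)
    show "k = r * r" by (simp add: r)
    show "z * b = b * z" if "z * h = h * z" for z
    proof -
      have "z * k = k * z" by (rule k(3)) (metis that mult.assoc)
      then show ?thesis by (simp add: b_def algebra_simps that)
    qed
    fix S assume S: "cstar_subalgebra S \<and> h \<in> S"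
    then show "k \<in> S" using k(4) subalg_mult[of S] by blast
    with S show "b \<in> S" by (auto simp: b_def intro: subalg_scaleR subalg_diff)
  qed
qed

text \<open>With \<open>b\<close> the negative part of \<open>h = star y * y\<close>, the element \<open>w = y b\<close> has \<open>star w * w = b h b = -b\<^sup>3\<close>,
  so it vanishes, and with it \<open>b\<close>.\<close>

lemma cpos_star_mult_self: "cpos (star y * (y :: 'a::cstar_algebra))"
proof -
  define h where "h = star y * y"
  have "star h = h" by (simp add: h_def star_mult star_star)
  then obtain k r b where k: "cpos k" and b: "star b = b" "b * h = - (b * b)" "b * b = k * b"
    "h = k - b - b" and r: "star r = r" "r * b = b * r" "k = r * r"
    using negative_part[of h] by blast
  have sq: "(r * b) * (r * b) = b * b * b"
    by (metis b(3) r(2,3) mult.assoc)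
  have "star (y * b) * (y * b) = b * h * b"
    by (simp add: star_mult b(1) h_def mult.assoc)
  also have "\<dots> = - ((r * b) * (r * b))" by (simp add: b(2) sq)
  finally have "y * b = 0"
    by (intro star_mult_self_eq_neg_square[of "r * b"]) (simp_all add: star_mult b r)
  then have "b * h = 0" by (metis h_def b(1) mult.assoc star_mult star_star star_0 mult_zero_left mult_zero_right)
  then have "b * b = 0" using b(2) by simp
  then have "b = 0" using norm_selfadjoint_square[OF b(1)] by simp
  with b(4) k show ?thesis by (simp add: h_def)
qed

lemma positive_in_iff:
  assumes S: "cstar_subalgebra S"
  shows "positive_in S x \<longleftrightarrow> x \<in> S \<and> cpos x"
proof
  assume "positive_in S x"
  then show "x \<in> S \<and> cpos x"
    by (auto simp: positive_in_def cpos_star_mult_self intro: subalg_mult[OF S] subalg_star[OF S])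
next
  assume x: "x \<in> S \<and> cpos x"
  then obtain s where "cpos s" "s * s = x" "s \<in> S" using cpos_sqrt_exists[of x] S by blast
  then show "positive_in S x" unfolding positive_in_def by (metis cpos_selfadjoint)
qed

section \<open>The centre of a simple C*-algebra\<close>

text \<open>The annihilator in \<open>B\<close> of a central element is a closed ideal, so it is \<open>{0}\<close> or \<open>B\<close>. Applied to the
  negative part of \<open>h - t\<close>, which annihilates the positive part, this shows that every real number \<open>t\<close>
  satisfies \<open>t \<le> h\<close> or \<open>h \<le> t\<close>. So \<open>h\<close> is the real number that defines this cut.\<close>

lemma simple_center_selfadjoint:
  assumes B: "simple_cstar B" and h: "h \<in> B" "star h = h" and comm: "\<And>b. b \<in> B \<Longrightarrow> b * h = h * b"
  shows "\<exists>r. h = of_real r"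
proof -
  have S: "cstar_subalgebra B" using B by (simp add: simple_cstar_def)
  have dich: "cpos (h - of_real t) \<or> cpos (of_real t - h)" for t
  proof -
    let ?g = "h - of_real t"
    have g: "star ?g = ?g" "?g \<in> B" "\<And>b. b \<in> B \<Longrightarrow> b * ?g = ?g * b"
      by (auto simp: star_diff h algebra_simps comm of_real_commute intro: subalg_diff[OF S] subalg_of_real[OF S])
    obtain k b where k: "cpos k" and b: "star b = b" "b * ?g = - (b * b)" "?g = k - b - b"
      and k_in: "k \<in> B" "b \<in> B" and bk: "b * b = k * b"
      and bc: "\<And>z. z \<in> B \<Longrightarrow> z * b = b * z"
      using negative_part[OF g(1)] g(2,3) S by blast
    define I where "I = {x \<in> B. b * x = 0}"
    have "closed I"
    proof -
      have "closed ((\<lambda>x. b * x) -` {0})"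
        by (intro closed_vimage closed_singleton continuous_intros)
      moreover have "I = B \<inter> (\<lambda>x. b * x) -` {0}" by (auto simp: I_def)
      ultimately show ?thesis using subalg_closed[OF S] by auto
    qed
    moreover have "b * (s * x) = 0" if "s \<in> B" "b * x = 0" for s x
      by (metis bc that mult.assoc mult_zero_right)
    moreover have "b * (x * s) = 0" if "b * x = 0" for s x
      using that by (simp flip: mult.assoc)
    ultimately have "closed_ideal B I"
      unfolding closed_ideal_def I_def
      by (auto simp: distrib_left mult_scaleC_right intro: subalg_0[OF S] subalg_add[OF S]
          subalg_scaleC[OF S] subalg_mult[OF S])
    then have "I = {0} \<or> I = B" using B by (simp add: simple_cstar_def)
    then show ?thesis
    proof
      assume I: "I = {0}"
      have kb: "k * b = b * k" by (rule bc[OF k_in(1)])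
      have "b * (k - b) = 0" using bk kb by (simp add: right_diff_distrib)
      then have "k - b \<in> I" using k_in by (simp add: I_def subalg_diff[OF S])
      then have "of_real t - h = k" using I b(3) by (simp add: algebra_simps)
      with k show ?thesis by simp
    next
      assume "I = B"
      then have "1 \<in> I" using subalg_1[OF S] by simp
      then have "b = 0" by (simp add: I_def)
      with b(3) k show ?thesis by simp
    qed
  qed
  \<comment> \<open>\<open>X\<close> is the lower half of the cut, and \<open>h\<close> will be its supremum.\<close>
  define X where "X = {t. cpos (h - of_real t)}"
  have low: "- norm h \<in> X"
  proof -
    have "norm (of_real (norm h) - (h + of_real (norm h))) \<le> norm h" by simp
    then have "cpos (h + of_real (norm h))"
      by (intro cposI_norm[of _ "norm h"]) (simp_all add: star_add h)
    then show ?thesis by (simp add: X_def)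
  qed
  have up: "t \<le> norm h" if "t \<in> X" for t
  proof -
    have "cpos (of_real (norm h) - h)"
      by (rule cposI_norm[of _ "norm h"]) (simp_all add: star_diff h)
    then have "cpos ((of_real (norm h) - h) + (h - of_real t))"
      using that by (intro cpos_add) (simp_all add: X_def)
    then have "cpos (of_real (norm h - t) :: 'a)" by simp
    then show ?thesis unfolding cpos_of_real_iff by simp
  qed
  have bdd: "bdd_above X" using up by (auto simp: bdd_above_def)
  let ?m = "Sup X"
  have "norm (h - of_real ?m) \<le> e" if e: "e > 0" for e
  proof -
    have "\<exists>x\<in>X. ?m - e / 4 < x" using less_cSup_iff[of X "?m - e/4"] low bdd e by auto
    then obtain s where s: "s \<in> X" "?m - e / 4 < s" by blast
    have sm: "s \<le> ?m" using s bdd by (simp add: cSup_upper)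
    have "?m + e / 4 \<notin> X" using cSup_upper[OF _ bdd, of "?m + e / 4"] e by auto
    then have "cpos (of_real (?m + e / 4) - h)" using dich unfolding X_def by blast
    then have "norm (h - of_real s) \<le> ?m + e / 4 - s"
      using s(1) sm e by (intro norm_le_of_positive_diff) (simp_all add: X_def algebra_simps)
    moreover have "norm (of_real s - of_real ?m :: 'a) \<le> e / 4"
      unfolding of_real_diff[symmetric] norm_of_real using s(2) sm by simp
    ultimately show ?thesis
      using norm_triangle_ineq[of "h - of_real s" "of_real s - of_real ?m"] s(2) e by simp
  qed
  then have "norm (h - of_real ?m) \<le> 0" by (rule field_le_epsilon) simp_all
  then show ?thesis by auto
qed

lemma simple_center:
  assumes B: "simple_cstar B" and x: "x \<in> B" and comm: "\<And>b. b \<in> B \<Longrightarrow> b * x = x * b"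
  shows "\<exists>c. x = c *\<^sub>C 1"
proof -
  have S: "cstar_subalgebra B" using B by (simp add: simple_cstar_def)
  have comm': "b * star x = star x * b" if "b \<in> B" for b
    using arg_cong[OF comm[OF subalg_star[OF S that]], of star] by (simp add: star_mult star_star)
  obtain p q where p: "star p = p" and q: "star q = q" and eq: "x = p + \<i> *\<^sub>C q"
    and pq: "\<forall>z. z * x = x * z \<and> z * star x = star x * z \<longrightarrow> z * p = p * z \<and> z * q = q * z"
      "\<forall>S. cstar_subalgebra S \<and> x \<in> S \<longrightarrow> p \<in> S \<and> q \<in> S"
    using cartesian_decomposition[of x] by blast
  have pB: "p \<in> B" "\<And>b. b \<in> B \<Longrightarrow> b * p = p * b" and qB: "q \<in> B" "\<And>b. b \<in> B \<Longrightarrow> b * q = q * b"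
    using pq S x comm comm' by metis+
  obtain r s where "p = of_real r" "q = of_real s"
    using simple_center_selfadjoint[OF B pB(1) p pB(2)] simple_center_selfadjoint[OF B qB(1) q qB(2)] by blast
  then have "x = (of_real r + \<i> * of_real s) *\<^sub>C 1"
    by (simp add: eq of_real_scaleC scaleC_add_left scaleC_scaleC)
  then show ?thesis by blast
qed

section \<open>Expectations with a quasi-basis\<close>

locale expectation =
  fixes A B :: "'a::cstar_algebra set" and E :: "'a \<Rightarrow> 'a"
  assumes subalg_A: "cstar_subalgebra A" and subalg_B: "cstar_subalgebra B" and BA: "B \<subseteq> A"
    and cond_exp: "conditional_expectation A B E"
begin

lemma E_in: "x \<in> A \<Longrightarrow> E x \<in> B" and E_id: "b \<in> B \<Longrightarrow> E b = b"
  and E_add: "x \<in> A \<Longrightarrow> y \<in> A \<Longrightarrow> E (x + y) = E x + E y"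
  and E_scaleC: "x \<in> A \<Longrightarrow> E (c *\<^sub>C x) = c *\<^sub>C E x"
  and E_norm: "x \<in> A \<Longrightarrow> norm (E x) \<le> norm x"
  and E_bimodule: "a \<in> B \<Longrightarrow> b \<in> B \<Longrightarrow> x \<in> A \<Longrightarrow> E (a * x * b) = a * E x * b"
  using cond_exp by (auto simp: conditional_expectation_def)

lemma E_in_A: "x \<in> A \<Longrightarrow> E x \<in> A"
  using E_in BA by blast

lemmas A_closed = subalg_1[OF subalg_A] subalg_0[OF subalg_A] subalg_add[OF subalg_A]
  subalg_diff[OF subalg_A] subalg_mult[OF subalg_A] subalg_scaleC[OF subalg_A]
  subalg_scaleR[OF subalg_A] subalg_star[OF subalg_A] subalg_sum[OF subalg_A] subalg_of_real[OF subalg_A] E_in_A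
lemmas B_closed = subalg_1[OF subalg_B] subalg_0[OF subalg_B] subalg_add[OF subalg_B]
  subalg_diff[OF subalg_B] subalg_mult[OF subalg_B] subalg_scaleC[OF subalg_B]
  subalg_scaleR[OF subalg_B] subalg_star[OF subalg_B] subalg_sum[OF subalg_B] subalg_of_real[OF subalg_B] E_in

lemma E_cpos: "x \<in> A \<Longrightarrow> cpos x \<Longrightarrow> cpos (E x)"
  using cond_exp positive_in_iff[OF subalg_A] positive_in_iff[OF subalg_B]
  by (auto simp: conditional_expectation_def)

lemma E_left: "a \<in> B \<Longrightarrow> x \<in> A \<Longrightarrow> E (a * x) = a * E x"
  using E_bimodule[of a 1 x] by (simp add: B_closed)

lemma E_right: "b \<in> B \<Longrightarrow> x \<in> A \<Longrightarrow> E (x * b) = E x * b"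
  using E_bimodule[of 1 b x] by (simp add: B_closed)

lemma E_0: "E 0 = 0"
  by (simp add: E_id B_closed)

lemma E_scaleR: "x \<in> A \<Longrightarrow> E (r *\<^sub>R x) = r *\<^sub>R E x"
  by (simp add: scaleR_scaleC E_scaleC)

lemma E_diff: "x \<in> A \<Longrightarrow> y \<in> A \<Longrightarrow> E (x - y) = E x - E y"
  using E_add[of x "(-1) *\<^sub>R y"] E_scaleR[of y "-1"] by (simp add: subalg_uminus[OF subalg_A])

lemma E_sum: "(\<And>i. i \<in> I \<Longrightarrow> f i \<in> A) \<Longrightarrow> E (sum f I) = (\<Sum>i\<in>I. E (f i))"
  by (induction I rule: infinite_finite_induct) (simp_all add: E_0 E_add A_closed)

lemma E_star: "x \<in> A \<Longrightarrow> E (star x) = star (E x)"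
proof -
  have self: "star (E p) = E p" if p: "p \<in> A" "star p = p" for p
  proof -
    have "p = (1/4) *\<^sub>R ((p + 1) * (p + 1) - (p - 1) * (p - 1))"
      by (simp add: algebra_simps flip: scaleR_add_left)
    then have "E p = (1/4) *\<^sub>R (E ((p + 1) * (p + 1)) - E ((p - 1) * (p - 1)))"
      by (metis E_scaleR E_diff A_closed p(1))
    moreover have "star (E ((p + 1) * (p + 1))) = E ((p + 1) * (p + 1))"
      by (rule cpos_selfadjoint[OF E_cpos[OF _ cpos_square]]) (simp_all add: star_add A_closed p)
    moreover have "star (E ((p - 1) * (p - 1))) = E ((p - 1) * (p - 1))"
      by (rule cpos_selfadjoint[OF E_cpos[OF _ cpos_square]]) (simp_all add: star_diff A_closed p)
    ultimately show ?thesis by (metis star_diff star_scaleR)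
  qed
  assume x: "x \<in> A"
  obtain p q where p: "star p = p" and q: "star q = q" and eq: "x = p + \<i> *\<^sub>C q" "star x = p - \<i> *\<^sub>C q"
    and "\<forall>S. cstar_subalgebra S \<and> x \<in> S \<longrightarrow> p \<in> S \<and> q \<in> S"
    using cartesian_decomposition[of x] by blast
  then have pA: "p \<in> A" and qA: "q \<in> A" using subalg_A x by auto
  have "E (star x) = E p - \<i> *\<^sub>C E q"
    unfolding eq(2) by (simp add: E_diff E_scaleC A_closed pA qA)
  also have "\<dots> = star (E p + \<i> *\<^sub>C E q)"
    by (simp add: star_add star_scaleC self p q pA qA)
  also have "\<dots> = star (E x)"
    unfolding eq(1) by (simp add: E_add E_scaleC A_closed pA qA)
  finally show ?thesis .
qed

end

text \<open>A quasi-basis plays the role of an orthonormal basis of the right \<open>B\<close>-module \<open>A\<close>: \<open>expand_left\<close> is the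
  Fourier expansion and \<open>gram_factor\<close> is Parseval's identity.\<close>

locale based_expectation = expectation A B E
    for A B :: "'a::cstar_algebra set" and E :: "'a \<Rightarrow> 'a" +
  fixes n :: nat and u :: "nat \<Rightarrow> 'a"
  assumes basis: "quasi_basis A E n u"
begin

lemma u_in: "i < n \<Longrightarrow> u i \<in> A"
  using basis by (simp add: quasi_basis_def)

lemma expand_left: "x \<in> A \<Longrightarrow> (\<Sum>i<n. u i * E (star (u i) * x)) = x"
  and expand_right: "x \<in> A \<Longrightarrow> (\<Sum>i<n. E (x * u i) * star (u i)) = x"
  using basis by (simp_all add: quasi_basis_def)

lemma gram_factor:
  assumes "x \<in> A" "y \<in> A"
  shows "E (star x * y) = (\<Sum>l<n. E (star x * u l) * E (star (u l) * y))"
proof -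
  have "E (star x * y) = E (star x * (\<Sum>l<n. u l * E (star (u l) * y)))"
    by (simp add: expand_left assms)
  also have "\<dots> = (\<Sum>l<n. E (star x * u l * E (star (u l) * y)))"
    unfolding sum_distrib_left mult.assoc by (rule E_sum) (simp add: A_closed u_in assms)
  also have "\<dots> = (\<Sum>l<n. E (star x * u l) * E (star (u l) * y))"
    by (rule sum.cong) (simp_all add: E_right B_closed A_closed u_in assms)
  finally show ?thesis .
qed

text \<open>The complete positivity of \<open>E\<close>, made explicit: factoring \<open>E (star (w j) * w k)\<close> through the
  quasi-basis exhibits the double sum as \<open>\<Sum>l. star (z l) * z l\<close>.\<close>

lemma cpos_gram:
  assumes "\<And>j. j \<in> J \<Longrightarrow> w j \<in> A"
  shows "cpos (\<Sum>j\<in>J. \<Sum>k\<in>J. a j * E (star (w j) * w k) * star (a k))"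
proof -
  define z where "z l = (\<Sum>k\<in>J. E (star (u l) * w k) * star (a k))" for l
  have st: "star (z l) = (\<Sum>j\<in>J. a j * E (star (w j) * u l))" if "l < n" for l
    using assms that
    by (simp add: z_def star_sum star_mult star_star A_closed u_in flip: E_star)
  have "(\<Sum>j\<in>J. \<Sum>k\<in>J. a j * E (star (w j) * w k) * star (a k))
      = (\<Sum>j\<in>J. \<Sum>k\<in>J. \<Sum>l<n. a j * E (star (w j) * u l) * (E (star (u l) * w k) * star (a k)))"
    using assms by (intro sum.cong refl) (simp add: gram_factor sum_distrib_left sum_distrib_right mult.assoc)
  also have "\<dots> = (\<Sum>l<n. \<Sum>j\<in>J. \<Sum>k\<in>J. a j * E (star (w j) * u l) * (E (star (u l) * w k) * star (a k)))"
    by (subst (2) sum.swap, subst sum.swap, rule refl)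
  also have "\<dots> = (\<Sum>l<n. star (z l) * z l)"
    by (intro sum.cong refl) (simp add: st, simp add: z_def sum_product)
  finally show ?thesis by (simp add: cpos_sum cpos_star_mult_self)
qed

lemma E_faithful:
  assumes x: "x \<in> A" and 0: "E (star x * x) = 0"
  shows "x = 0"
proof -
  define q where "q l = E (star (u l) * x)" for l
  have st: "E (star x * u l) = star (q l)" if "l < n" for l
    using x that by (simp add: q_def star_mult star_star A_closed u_in flip: E_star)
  have sum0: "(\<Sum>l<n. star (q l) * q l) = 0"
    using gram_factor[OF x x] 0 by (simp add: q_def[symmetric] st)
  have "q l = 0" if "l < n" for l
  proof -
    have "star (q l) * q l + (\<Sum>l\<in>{..<n} - {l}. star (q l) * q l) = 0"
      using sum0 sum.remove[of "{..<n}" l "\<lambda>l. star (q l) * q l"] that by simp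
    then have "star (q l) * q l = 0"
      by (rule cpos_add_eq_0[OF cpos_star_mult_self cpos_sum[OF cpos_star_mult_self]])
    then show ?thesis using cstar_identity[of "q l"] by simp
  qed
  then show ?thesis using expand_left[OF x] by (simp add: q_def)
qed

lemma index_unique:
  assumes v: "quasi_basis A E m v"
  shows "(\<Sum>k<m. v k * star (v k)) = (\<Sum>j<n. u j * star (u j))"
proof -
  have vA: "k < m \<Longrightarrow> v k \<in> A" and vl: "x \<in> A \<Longrightarrow> (\<Sum>k<m. v k * E (star (v k) * x)) = x" for k x
    using v by (simp_all add: quasi_basis_def)
  have "(\<Sum>k<m. v k * star (v k)) = (\<Sum>k<m. v k * (\<Sum>j<n. E (star (v k) * u j) * star (u j)))"
    by (rule sum.cong) (simp_all add: expand_right A_closed vA)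
  also have "\<dots> = (\<Sum>j<n. (\<Sum>k<m. v k * E (star (v k) * u j)) * star (u j))"
    unfolding sum_distrib_left sum_distrib_right by (subst sum.swap) (simp add: mult.assoc)
  also have "\<dots> = (\<Sum>j<n. u j * star (u j))"
    by (rule sum.cong) (simp_all add: vl u_in)
  finally show ?thesis .
qed

lemma Ind_eq: "Ind A E = (\<Sum>j<n. u j * star (u j))"
  unfolding Ind_def using basis index_unique by (intro the_equality) blast+

text \<open>Bessel's inequality. Let \<open>w j\<close> be the component of \<open>u j\<close> orthogonal to \<open>F\<close>. Then the Gram matrix of
  the \<open>w j\<close> is the Gram matrix of the \<open>u j\<close> minus the contributions of the projection to \<open>F\<close>;
  sandwiching between the \<open>u j\<close> and collecting with the expansion formulas turns these two parts into
  the index and \<open>\<Sum>m. m * star m\<close>, and the Gram matrix of the \<open>w j\<close> into a positive element.\<close>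

lemma bessel:
  assumes fin: "finite F" and FA: "F \<subseteq> A"
    and orth: "\<And>x y. x \<in> F \<Longrightarrow> y \<in> F \<Longrightarrow> E (star x * y) = (if x = y then 1 else 0)"
  shows "cpos ((\<Sum>j<n. u j * star (u j)) - (\<Sum>m\<in>F. m * star m))"
proof -
  have m_in: "m \<in> F \<Longrightarrow> m \<in> A" for m using FA by blast
  define w where "w j = u j - (\<Sum>m\<in>F. m * E (star m * u j))" for j
  have w_in: "w j \<in> A" if "j < n" for j
    unfolding w_def using that by (intro A_closed u_in m_in)
  have mw: "E (star m * w k) = 0" if m: "m \<in> F" and k: "k < n" for m k
  proof -
    have "E (star m * w k) = E (star m * u k) - (\<Sum>m'\<in>F. E (star m * m') * E (star m' * u k))"
      using m k unfolding w_def right_diff_distrib sum_distrib_left mult.assoc[symmetric]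
      by (simp add: E_diff E_sum E_right A_closed B_closed u_in m_in)
    also have "(\<Sum>m'\<in>F. E (star m * m') * E (star m' * u k))
        = (\<Sum>m'\<in>F. if m = m' then E (star m' * u k) else 0)"
      by (rule sum.cong) (simp_all add: orth m)
    finally show ?thesis using fin m by simp
  qed
  have gram: "E (star (w j) * w k) = E (star (u j) * u k) - (\<Sum>m\<in>F. E (star (u j) * m) * E (star m * u k))"
    if j: "j < n" and k: "k < n" for j k
  proof -
    have sw: "star (w j) = star (u j) - (\<Sum>m\<in>F. E (star (u j) * m) * star m)"
      using j by (simp add: w_def star_diff star_sum star_mult star_star A_closed u_in m_in flip: E_star)
    have "E (star (w j) * w k) = E (star (u j) * w k) - (\<Sum>m\<in>F. E (star (u j) * m) * E (star m * w k))"
      using j k unfolding sw left_diff_distrib sum_distrib_right mult.assoc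
      by (simp add: E_diff E_sum E_left A_closed B_closed u_in m_in w_in)
    also have "\<dots> = E (star (u j) * w k)" by (simp add: mw k)
    also have "\<dots> = E (star (u j) * u k) - (\<Sum>m\<in>F. E (star (u j) * m) * E (star m * u k))"
      using j k unfolding w_def right_diff_distrib sum_distrib_left mult.assoc[symmetric]
      by (simp add: E_diff E_sum E_right A_closed B_closed u_in m_in)
    finally show ?thesis .
  qed
  have "(\<Sum>j<n. \<Sum>k<n. u j * E (star (w j) * w k) * star (u k))
      = (\<Sum>j<n. \<Sum>k<n. u j * E (star (u j) * u k) * star (u k))
        - (\<Sum>j<n. \<Sum>k<n. \<Sum>m\<in>F. u j * E (star (u j) * m) * (E (star m * u k) * star (u k)))"
    by (simp add: gram right_diff_distrib left_diff_distrib sum_subtractf sum_distrib_left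
        sum_distrib_right mult.assoc)
  also have "(\<Sum>j<n. \<Sum>k<n. u j * E (star (u j) * u k) * star (u k)) = (\<Sum>k<n. u k * star (u k))"
    by (subst sum.swap) (simp add: expand_left u_in flip: sum_distrib_right)
  also have "(\<Sum>j<n. \<Sum>k<n. \<Sum>m\<in>F. u j * E (star (u j) * m) * (E (star m * u k) * star (u k)))
      = (\<Sum>m\<in>F. \<Sum>j<n. \<Sum>k<n. u j * E (star (u j) * m) * (E (star m * u k) * star (u k)))"
    by (subst (2) sum.swap, subst sum.swap, rule refl)
  also have "\<dots> = (\<Sum>m\<in>F. m * star m)"
  proof (rule sum.cong[OF refl])
    fix m assume "m \<in> F"
    then show "(\<Sum>j<n. \<Sum>k<n. u j * E (star (u j) * m) * (E (star m * u k) * star (u k))) = m * star m"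
      unfolding sum_product[symmetric] by (simp add: expand_left expand_right A_closed m_in)
  qed
  finally show ?thesis using cpos_gram[of "{..<n}" w u] w_in by simp
qed

end

locale scalar_index_expectation = based_expectation A B E n u
    for A B :: "'a::cstar_algebra set" and E :: "'a \<Rightarrow> 'a" and n u +
  fixes r :: real
  assumes index: "(\<Sum>j<n. u j * star (u j)) = of_real r"
begin

text \<open>Bessel's inequality for the orthonormal set \<open>{1}\<close>.\<close>

lemma index_ge_1: "1 \<le> r"
proof -
  have "cpos (of_real r - (\<Sum>m\<in>{1 :: 'a}. m * star m))"
    unfolding index[symmetric] by (rule bessel) (simp_all add: A_closed E_id B_closed)
  then have "cpos (of_real (r - 1) :: 'a)" by simp
  then show ?thesis unfolding cpos_of_real_iff by simp
qed

lemma Ind_scalar: "Ind A E = of_real r"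
  by (simp add: Ind_eq index)

end

section \<open>The dimension of the relative commutant\<close>

lemma scaleC_1_inject: "c *\<^sub>C (1::'a::cstar_algebra) = d *\<^sub>C 1 \<longleftrightarrow> c = d"
proof
  assume "c *\<^sub>C (1::'a) = d *\<^sub>C 1"
  then have "(c - d) *\<^sub>C (1::'a) = 0" by (simp add: complex_vs.scale_left_diff_distrib)
  then show "c = d" by (simp add: complex_vs.scale_eq_0_iff)
qed simp

lemma star_span:
  assumes "x \<in> complex_vs.span G" "\<And>y. y \<in> G \<Longrightarrow> star y \<in> complex_vs.span H"
  shows "star x \<in> complex_vs.span H"
  using assms(1)
  by (induction rule: complex_vs.span_induct_alt)
    (auto simp: star_add star_scaleC intro: complex_vs.span_zero complex_vs.span_add complex_vs.span_scale assms(2))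

text \<open>When \<open>B\<close> is simple, its centre is \<open>\<complex>\<close>, so \<open>E\<close> restricts to a faithful state \<open>\<phi>\<close> on the relative
  commutant \<open>M\<close>, which becomes a complex inner product space under \<open>\<phi> (star x * y)\<close>.\<close>

locale simple_index = scalar_index_expectation A B E n u r
    for A B :: "'a::cstar_algebra set" and E :: "'a \<Rightarrow> 'a" and n u r +
  assumes simple_B: "simple_cstar B"
begin

definition M :: "'a set" where "M = relative_commutant B A"

definition \<phi> :: "'a \<Rightarrow> complex" where "\<phi> x = (THE c. E x = c *\<^sub>C 1)"

lemma M_A: "x \<in> M \<Longrightarrow> x \<in> A" and M_comm: "x \<in> M \<Longrightarrow> b \<in> B \<Longrightarrow> b * x = x * b"
  by (auto simp: M_def relative_commutant_def)

lemma M_I: "x \<in> A \<Longrightarrow> (\<And>b. b \<in> B \<Longrightarrow> b * x = x * b) \<Longrightarrow> x \<in> M"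
  by (auto simp: M_def relative_commutant_def)

lemma M_mult: "x \<in> M \<Longrightarrow> y \<in> M \<Longrightarrow> x * y \<in> M"
  by (rule M_I) (auto intro: A_closed M_A, metis M_comm mult.assoc)

lemma M_scaleC: "x \<in> M \<Longrightarrow> c *\<^sub>C x \<in> M"
  by (rule M_I) (simp_all add: A_closed M_A mult_scaleC_left mult_scaleC_right, metis M_comm)

lemma M_0: "0 \<in> M" by (rule M_I) (auto intro: A_closed)

lemma M_add: "x \<in> M \<Longrightarrow> y \<in> M \<Longrightarrow> x + y \<in> M"
  by (rule M_I) (simp_all add: A_closed M_A distrib_left distrib_right, metis M_comm)

lemma M_diff: "x \<in> M \<Longrightarrow> y \<in> M \<Longrightarrow> x - y \<in> M"
  by (rule M_I) (simp_all add: A_closed M_A left_diff_distrib right_diff_distrib, metis M_comm)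

lemma M_star: "x \<in> M \<Longrightarrow> star x \<in> M"
proof (rule M_I)
  fix b assume x: "x \<in> M" and b: "b \<in> B"
  have "star b * x = x * star b" using x b by (simp add: M_comm B_closed)
  from arg_cong[OF this, of star] show "b * star x = star x * b" by (simp add: star_mult star_star)
qed (simp add: A_closed M_A)

lemma M_sum: "(\<And>i. i \<in> I \<Longrightarrow> f i \<in> M) \<Longrightarrow> sum f I \<in> M"
  by (induction I rule: infinite_finite_induct) (simp_all add: M_0 M_add)

lemmas M_closed = M_mult M_scaleC M_0 M_add M_diff M_star M_sum

lemma \<phi>_eqI: "E x = c *\<^sub>C 1 \<Longrightarrow> \<phi> x = c"
  unfolding \<phi>_def by (rule the_equality) (simp_all add: scaleC_1_inject)

lemma E_\<phi>: assumes x: "x \<in> M" shows "E x = \<phi> x *\<^sub>C 1"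
proof -
  have "b * E x = E x * b" if "b \<in> B" for b
    using that x by (metis E_left E_right M_comm M_A)
  then obtain c where "E x = c *\<^sub>C 1"
    using simple_center[OF simple_B E_in[OF M_A[OF x]]] by blast
  then show ?thesis using \<phi>_eqI by simp
qed

lemma \<phi>_add: "x \<in> M \<Longrightarrow> y \<in> M \<Longrightarrow> \<phi> (x + y) = \<phi> x + \<phi> y"
  by (rule \<phi>_eqI) (simp add: E_add M_A E_\<phi> scaleC_add_left)

lemma \<phi>_scaleC: "x \<in> M \<Longrightarrow> \<phi> (c *\<^sub>C x) = c * \<phi> x"
  by (rule \<phi>_eqI) (simp add: E_scaleC M_A E_\<phi> scaleC_scaleC)

lemma \<phi>_star: "x \<in> M \<Longrightarrow> \<phi> (star x) = cnj (\<phi> x)"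
  by (rule \<phi>_eqI) (simp add: E_star M_A E_\<phi> star_scaleC)

lemma \<phi>_sum: "(\<And>i. i \<in> I \<Longrightarrow> f i \<in> M) \<Longrightarrow> \<phi> (sum f I) = (\<Sum>i\<in>I. \<phi> (f i))"
  by (rule \<phi>_eqI) (simp add: E_sum M_A E_\<phi> complex_vs.scale_sum_left)

definition orthonormal :: "'a set \<Rightarrow> bool" where
  "orthonormal F \<longleftrightarrow> finite F \<and> F \<subseteq> M \<and> (\<forall>x\<in>F. \<forall>y\<in>F. \<phi> (star x * y) = (if x = y then 1 else 0))"

lemma fourier:
  assumes O: "orthonormal F" and x: "x \<in> complex_vs.span F"
  shows "x = (\<Sum>m\<in>F. \<phi> (star m * x) *\<^sub>C m)"
proof -
  have fin: "finite F" and FM: "\<And>m. m \<in> F \<Longrightarrow> m \<in> M"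
    and orth: "\<And>x y. x \<in> F \<Longrightarrow> y \<in> F \<Longrightarrow> \<phi> (star x * y) = (if x = y then 1 else 0)"
    using O by (auto simp: orthonormal_def)
  obtain c where c: "x = (\<Sum>m\<in>F. c m *\<^sub>C m)"
    using x complex_vs.span_finite[OF fin] by auto
  have "\<phi> (star m * x) = c m" if m: "m \<in> F" for m
  proof -
    have "\<phi> (star m * x) = (\<Sum>k\<in>F. c k * \<phi> (star m * k))"
      unfolding c sum_distrib_left mult_scaleC_right
      by (simp add: \<phi>_sum \<phi>_scaleC M_closed FM m)
    also have "\<dots> = (\<Sum>k\<in>F. if m = k then c k else 0)"
      by (rule sum.cong) (simp_all add: orth m)
    finally show ?thesis using fin m by simp
  qed
  then show ?thesis by (subst c, intro sum.cong) simp_all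
qed

text \<open>One Gram-Schmidt step. Faithfulness of \<open>E\<close> allows the residual vector \<open>w\<close> to be normalized.\<close>

lemma orthonormal_extend:
  assumes O: "orthonormal F" and g: "g \<in> M"
  shows "\<exists>F'. orthonormal F' \<and> F \<subseteq> F' \<and> g \<in> complex_vs.span F' \<and>
    F' \<subseteq> complex_vs.span (insert g F) \<and> (g \<notin> complex_vs.span F \<longrightarrow> F \<subset> F')"
proof -
  have fin: "finite F" and FM: "\<And>m. m \<in> F \<Longrightarrow> m \<in> M"
    and orth: "\<And>x y. x \<in> F \<Longrightarrow> y \<in> F \<Longrightarrow> \<phi> (star x * y) = (if x = y then 1 else 0)"
    using O by (auto simp: orthonormal_def)
  define p where "p = (\<Sum>m\<in>F. \<phi> (star m * g) *\<^sub>C m)"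
  define w where "w = g - p"
  have p_span: "p \<in> complex_vs.span F"
    unfolding p_def by (intro complex_vs.span_sum complex_vs.span_scale complex_vs.span_base)
  have pM: "p \<in> M" unfolding p_def by (intro M_closed FM)
  have wM: "w \<in> M" unfolding w_def by (intro M_closed g pM)
  show ?thesis
  proof (cases "w = 0")
    case True
    then have "g = p" by (simp add: w_def)
    then show ?thesis using O p_span complex_vs.span_superset[of "insert g F"] by (intro exI[of _ F]) auto
  next
    case False
    have mw: "\<phi> (star m * w) = 0" if m: "m \<in> F" for m
    proof -
      have "\<phi> (star m * g) = \<phi> (star m * w) + \<phi> (star m * p)"
        by (subst \<phi>_add[symmetric]) (simp_all add: M_closed g FM m pM w_def flip: distrib_left)
      also have "\<phi> (star m * p) = (\<Sum>k\<in>F. \<phi> (star k * g) * \<phi> (star m * k))"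
        unfolding p_def sum_distrib_left mult_scaleC_right
        by (simp add: \<phi>_sum \<phi>_scaleC M_closed FM m)
      also have "\<dots> = (\<Sum>k\<in>F. if m = k then \<phi> (star k * g) else 0)"
        by (rule sum.cong) (simp_all add: orth m)
      finally show ?thesis using fin m by simp
    qed
    define c where "c = Re (\<phi> (star w * w))"
    have "cnj (\<phi> (star w * w)) = \<phi> (star w * w)"
      by (subst \<phi>_star[symmetric]) (simp_all add: M_closed wM star_mult star_star)
    then have c: "\<phi> (star w * w) = complex_of_real c"
      unfolding c_def by (metis Reals_cnj_iff of_real_Re)
    have Ec: "E (star w * w) = of_real c"
      by (subst E_\<phi>) (simp_all add: M_closed wM c of_real_scaleC)
    have "0 \<le> c"
      using E_cpos[OF _ cpos_star_mult_self, of w] wM by (simp add: Ec cpos_of_real_iff A_closed M_A)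
    moreover have "c \<noteq> 0" using E_faithful[OF M_A[OF wM]] False Ec by auto
    ultimately have c0: "c > 0" by simp
    define v where "v = complex_of_real (1 / sqrt c) *\<^sub>C w"
    have vM: "v \<in> M" by (simp add: v_def M_closed wM)
    have vv: "\<phi> (star v * v) = 1"
    proof -
      have "star v * v = complex_of_real (1 / c) *\<^sub>C (star w * w)"
        using c0 by (simp add: v_def star_scaleC mult_scaleC_left mult_scaleC_right scaleC_scaleC
            flip: of_real_mult)
      then show ?thesis using c0 by (simp add: \<phi>_scaleC M_closed wM c)
    qed
    have mv: "\<phi> (star m * v) = 0" if "m \<in> F" for m
      using that by (simp add: v_def mult_scaleC_right \<phi>_scaleC M_closed wM FM mw)
    have vm: "\<phi> (star v * m) = 0" if m: "m \<in> F" for m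
    proof -
      have "\<phi> (star v * m) = cnj (\<phi> (star m * v))"
        by (subst \<phi>_star[symmetric]) (simp_all add: M_closed vM FM m star_mult star_star)
      then show ?thesis by (simp add: mv m)
    qed
    have vF: "v \<notin> F" using mv[of v] vv by auto
    have w_eq: "w = complex_of_real (sqrt c) *\<^sub>C v"
      using c0 by (simp add: v_def scaleC_scaleC scaleC_one flip: of_real_mult)
    have "orthonormal (insert v F)"
      using vF by (auto simp: orthonormal_def fin vM FM vv mv vm orth)
    moreover have "g \<in> complex_vs.span (insert v F)"
    proof -
      have "g = w + p" by (simp add: w_def)
      moreover have "w \<in> complex_vs.span (insert v F)"
        unfolding w_eq by (intro complex_vs.span_scale complex_vs.span_base) simp
      moreover have "p \<in> complex_vs.span (insert v F)"
        using p_span complex_vs.span_mono[of F "insert v F"] by blast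
      ultimately show ?thesis by (simp add: complex_vs.span_add)
    qed
    moreover have "insert v F \<subseteq> complex_vs.span (insert g F)"
    proof -
      have "p \<in> complex_vs.span (insert g F)"
        using p_span complex_vs.span_mono[of F "insert g F"] by blast
      then have "v \<in> complex_vs.span (insert g F)"
        unfolding v_def w_def
        by (intro complex_vs.span_scale complex_vs.span_diff) (simp_all add: complex_vs.span_base)
      moreover have "F \<subseteq> complex_vs.span (insert g F)"
        using complex_vs.span_superset[of "insert g F"] by blast
      ultimately show ?thesis by blast
    qed
    ultimately show ?thesis using vF by (intro exI[of _ "insert v F"]) auto
  qed
qed

text \<open>Bessel's inequality bounds \<open>\<Sum>m. \<phi> (m * star m)\<close> by the index, but the vectors are normalized by
  \<open>\<phi> (star m * m) = 1\<close> and \<open>\<phi>\<close> need not be a trace. Let \<open>S\<close> be the matrix of the involution in the basis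
  \<open>F\<close>. Then \<open>\<Sum>m. \<phi> (m * star m)\<close> is its squared Hilbert-Schmidt norm, and \<open>star (star m) = m\<close> says that
  \<open>S\<close> times its entrywise conjugate is the identity. Taking the trace of this product and applying
  the Cauchy-Schwarz inequality gives \<open>card F \<le> \<Sum>m. \<phi> (m * star m)\<close>.\<close>

lemma card_orthonormal_le_index:
  assumes O: "orthonormal F" and star_closed: "\<And>m. m \<in> F \<Longrightarrow> star m \<in> complex_vs.span F"
  shows "real (card F) \<le> r"
proof -
  have fin: "finite F" and FM: "\<And>m. m \<in> F \<Longrightarrow> m \<in> M"
    and orth: "\<And>x y. x \<in> F \<Longrightarrow> y \<in> F \<Longrightarrow> \<phi> (star x * y) = (if x = y then 1 else 0)"
    using O by (auto simp: orthonormal_def)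
  \<comment> \<open>\<open>S m k\<close> is the coefficient of \<open>k\<close> in the expansion of \<open>star m\<close>.\<close>
  define S where "S m k = \<phi> (star k * star m)" for m k
  have conj: "\<phi> (k * m) = cnj (S k m)" if "k \<in> M" "m \<in> M" for k m
    unfolding S_def by (subst \<phi>_star[symmetric]) (simp_all add: M_closed that star_mult star_star)
  have sm: "star m = (\<Sum>k\<in>F. S m k *\<^sub>C k)" if "m \<in> F" for m
    unfolding S_def by (rule fourier[OF O star_closed[OF that]])
  have one: "(\<Sum>k\<in>F. S m k * cnj (S k m)) = 1" if m: "m \<in> F" for m
  proof -
    have "1 = \<phi> (star m * m)" by (simp add: orth m)
    also have "\<dots> = (\<Sum>k\<in>F. S m k * \<phi> (k * m))"
      by (subst sm[OF m]) (simp add: sum_distrib_right mult_scaleC_left \<phi>_sum \<phi>_scaleC M_closed FM m)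
    also have "\<dots> = (\<Sum>k\<in>F. S m k * cnj (S k m))"
      by (rule sum.cong) (simp_all add: conj FM m)
    finally show ?thesis by simp
  qed
  have mm: "\<phi> (m * star m) = (\<Sum>k\<in>F. complex_of_real ((cmod (S m k))\<^sup>2))" if m: "m \<in> F" for m
  proof -
    have "\<phi> (m * star m) = (\<Sum>k\<in>F. S m k * \<phi> (m * k))"
      by (subst sm[OF m]) (simp add: sum_distrib_left mult_scaleC_right \<phi>_sum \<phi>_scaleC M_closed FM m)
    also have "\<dots> = (\<Sum>k\<in>F. complex_of_real ((cmod (S m k))\<^sup>2))"
      by (rule sum.cong) (simp_all only: conj FM m complex_norm_square)
    finally show ?thesis .
  qed
  let ?s = "\<Sum>m\<in>F. \<Sum>k\<in>F. (cmod (S m k))\<^sup>2"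
  have "real (card F) = Re (\<Sum>m\<in>F. \<Sum>k\<in>F. S m k * cnj (S k m))"
    by (simp add: one)
  also have "\<dots> \<le> (\<Sum>m\<in>F. \<Sum>k\<in>F. ((cmod (S m k))\<^sup>2 + (cmod (S k m))\<^sup>2) / 2)"
    unfolding Re_sum
  proof (intro sum_mono)
    fix m k
    have "Re (S m k * cnj (S k m)) \<le> cmod (S m k) * cmod (S k m)"
      using complex_Re_le_cmod[of "S m k * cnj (S k m)"] by (simp add: norm_mult)
    then show "Re (S m k * cnj (S k m)) \<le> ((cmod (S m k))\<^sup>2 + (cmod (S k m))\<^sup>2) / 2"
      using sum_squares_bound[of "cmod (S m k)" "cmod (S k m)"] by simp
  qed
  also have "\<dots> = (?s + (\<Sum>m\<in>F. \<Sum>k\<in>F. (cmod (S k m))\<^sup>2)) / 2"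
    by (simp add: sum.distrib flip: sum_divide_distrib)
  also have "(\<Sum>m\<in>F. \<Sum>k\<in>F. (cmod (S k m))\<^sup>2) = ?s"
    by (rule sum.swap)
  finally have "real (card F) \<le> ?s" by simp
  also have "?s \<le> r"
  proof -
    have sub: "(\<Sum>m\<in>F. m * star m) \<in> A" by (intro A_closed M_A FM)
    have "E (\<Sum>m\<in>F. m * star m) = \<phi> (\<Sum>m\<in>F. m * star m) *\<^sub>C 1"
      by (intro E_\<phi> M_closed FM)
    also have "\<phi> (\<Sum>m\<in>F. m * star m) = complex_of_real ?s"
      by (simp add: \<phi>_sum M_closed FM mm)
    finally have "E (of_real r - (\<Sum>m\<in>F. m * star m)) = of_real (r - ?s)"
      using sub by (simp add: E_diff A_closed E_id B_closed of_real_scaleC complex_vs.scale_left_diff_distrib del: of_real_sum of_real_power)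
    moreover have "cpos (of_real r - (\<Sum>m\<in>F. m * star m))"
      unfolding index[symmetric]
      by (rule bessel[OF fin]) (auto simp: FM M_A E_\<phi> M_closed orth scaleC_one)
    ultimately have "cpos (of_real (r - ?s) :: 'a)"
      using E_cpos[of "of_real r - (\<Sum>m\<in>F. m * star m)"] sub by (simp add: A_closed del: of_real_diff)
    then show ?thesis unfolding cpos_of_real_iff by simp
  qed
  finally show ?thesis .
qed

text \<open>An orthonormal set of maximal size among those with star-closed span has to span \<open>M\<close>: otherwise
  adjoining a further \<open>g\<close> and \<open>star g\<close> would enlarge it. This yields finite dimensionality and the bound
  at once.\<close>

theorem dim_relative_commutant_le:
  "finite_dimC (relative_commutant B A) \<and> real (complex_vs.dim (relative_commutant B A)) \<le> r"
proof -
  define P where "P F \<longleftrightarrow> orthonormal F \<and> (\<forall>m\<in>F. star m \<in> complex_vs.span F)" for F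
  have bound: "real (card F) \<le> r" if "P F" for F
    using that card_orthonormal_le_index[of F] by (auto simp: P_def)
  have "P {}" by (simp add: P_def orthonormal_def)
  moreover have "\<forall>F. P F \<longrightarrow> card F < Suc (nat \<lfloor>r\<rfloor>)" using bound by (auto simp: le_nat_floor less_Suc_eq_le)
  ultimately have "\<exists>F. P F \<and> (\<forall>F'. P F' \<longrightarrow> card F' \<le> card F)" by (rule ex_has_greatest_nat)
  then obtain F where F: "P F" and max: "\<And>F'. P F' \<Longrightarrow> card F' \<le> card F" by auto
  have O: "orthonormal F" using F by (simp add: P_def)
  have "g \<in> complex_vs.span F" if g: "g \<in> M" for g
  proof (rule ccontr)
    assume nin: "g \<notin> complex_vs.span F"
    obtain F1 where F1: "orthonormal F1" "g \<in> complex_vs.span F1"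
      "F1 \<subseteq> complex_vs.span (insert g F)" "F \<subset> F1"
      using orthonormal_extend[OF O g] nin by blast
    obtain F2 where F2: "orthonormal F2" "F1 \<subseteq> F2" "star g \<in> complex_vs.span F2"
      "F2 \<subseteq> complex_vs.span (insert (star g) F1)"
      using orthonormal_extend[OF F1(1) M_star[OF g]] by blast
    let ?G = "insert (star g) (insert g F)"
    have F2G: "F2 \<subseteq> complex_vs.span ?G"
    proof -
      have "F1 \<subseteq> complex_vs.span ?G"
        using F1(3) complex_vs.span_mono[of "insert g F" ?G] by blast
      then have "insert (star g) F1 \<subseteq> complex_vs.span ?G"
        by (simp add: complex_vs.span_base)
      then have "complex_vs.span (insert (star g) F1) \<subseteq> complex_vs.span ?G"
        by (rule complex_vs.span_minimal) (rule complex_vs.subspace_span)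
      then show ?thesis using F2(4) by blast
    qed
    have mono: "complex_vs.span F \<subseteq> complex_vs.span F2" "complex_vs.span F1 \<subseteq> complex_vs.span F2"
      using F1(4) F2(2) by (auto intro!: complex_vs.span_mono)
    have "star y \<in> complex_vs.span F2" if "y \<in> ?G" for y
      using that mono F2(3) F1(2) F by (auto simp: P_def star_star)
    then have "P F2" using F2(1) F2G star_span[of _ ?G F2] by (auto simp: P_def)
    then have "card F2 \<le> card F" by (rule max)
    moreover have "card F < card F2"
      using F1(4) F2(1,2) by (intro psubset_card_mono) (auto simp: orthonormal_def)
    ultimately show False by simp
  qed
  then have sub: "relative_commutant B A \<subseteq> complex_vs.span F" by (auto simp: M_def)
  have fin: "finite F" using O by (simp add: orthonormal_def)
  have "complex_vs.dim (relative_commutant B A) \<le> card F"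
    by (rule complex_vs.dim_le_card[OF sub fin])
  then show ?thesis using sub fin bound[OF F] unfolding finite_dimC_def by force
qed

end

section \<open>Composition of expectations\<close>

lemma sum_div_mod: "(\<Sum>l<m * n. g (l div n) (l mod n)) = (\<Sum>j<m. \<Sum>i<(n::nat). g j i)"
proof -
  have "(\<Sum>l = j * n..<j * n + n. g (l div n) (l mod n)) = (\<Sum>i<n. g j i)" for j
    using sum.shift_bounds_nat_ivl[of "\<lambda>l. g (l div n) (l mod n)" 0 "j * n" n]
    by (simp add: atLeast0LessThan add.commute)
  then show ?thesis
    using sum.nat_group[of "\<lambda>l. g (l div n) (l mod n)" n m] by simp
qed

lemma expectation_compose:
  assumes "expectation A1 A E1" "expectation A B E0"
  shows "expectation A1 B (\<lambda>x. E0 (E1 x))"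
proof -
  interpret E1: expectation A1 A E1 by fact
  interpret E0: expectation A B E0 by fact
  show ?thesis
  proof unfold_locales
    show "cstar_subalgebra A1" "cstar_subalgebra B" by (fact E1.subalg_A E0.subalg_B)+
    show "B \<subseteq> A1" using E1.BA E0.BA by blast
    show "conditional_expectation A1 B (\<lambda>x. E0 (E1 x))"
      unfolding conditional_expectation_def
    proof (intro conjI ballI allI impI)
      fix x assume x: "x \<in> A1"
      show "norm (E0 (E1 x)) \<le> norm x"
        using E0.E_norm[OF E1.E_in[OF x]] E1.E_norm[OF x] by simp
      fix a b assume "a \<in> B" "b \<in> B"
      then show "E0 (E1 (a * x * b)) = a * E0 (E1 x) * b"
        using E0.BA x by (simp add: E1.E_bimodule E0.E_bimodule E1.E_in subset_iff)
    next
      fix x assume "positive_in A1 x"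
      then show "positive_in B (E0 (E1 x))"
        by (simp add: positive_in_iff E1.subalg_A E0.subalg_B E0.E_in E1.E_in E0.E_cpos E1.E_cpos)
    next
      fix b assume "b \<in> B"
      then show "E0 (E1 b) = b" using E0.BA by (simp add: E1.E_id E0.E_id subset_iff)
    qed (simp_all add: E1.E_add E0.E_add E1.E_scaleC E0.E_scaleC E0.E_in E1.E_in)
  qed
qed

text \<open>The products \<open>v j * u i\<close> form a quasi-basis of the composition. They are enumerated by
  \<open>l = j * n + i\<close>, that is \<open>j = l div n\<close> and \<open>i = l mod n\<close>.\<close>

lemma index_compose:
  assumes "scalar_index_expectation A1 A E1 m v s" "scalar_index_expectation A B E0 n u r"
  shows "\<exists>w. scalar_index_expectation A1 B (\<lambda>x. E0 (E1 x)) (m * n) w (r * s)"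
proof -
  interpret E1: scalar_index_expectation A1 A E1 m v s by fact
  interpret E0: scalar_index_expectation A B E0 n u r by fact
  interpret C: expectation A1 B "\<lambda>x. E0 (E1 x)"
    by (rule expectation_compose) unfold_locales
  have uA1: "i < n \<Longrightarrow> u i \<in> A1" for i using E0.u_in E1.BA by blast
  define w where "w l = v (l div n) * u (l mod n)" for l
  have idx: "l div n < m" "l mod n < n" if "l < m * n" for l
  proof -
    have "n > 0" using that by (cases n) simp_all
    then show "l div n < m" "l mod n < n" using that by (simp_all add: less_mult_imp_div_less)
  qed
  have "scalar_index_expectation A1 B (\<lambda>x. E0 (E1 x)) (m * n) w (r * s)"
  proof unfold_locales
    show "quasi_basis A1 (\<lambda>x. E0 (E1 x)) (m * n) w"
      unfolding quasi_basis_def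
    proof (intro conjI allI impI ballI)
      show "w l \<in> A1" if "l < m * n" for l
        unfolding w_def using idx[OF that] by (intro E1.A_closed E1.u_in uA1)
      fix x assume x: "x \<in> A1"
      have "(\<Sum>l<m * n. w l * E0 (E1 (star (w l) * x)))
          = (\<Sum>j<m. \<Sum>i<n. (v j * u i) * E0 (E1 (star (v j * u i) * x)))"
        unfolding w_def by (rule sum_div_mod)
      also have "\<dots> = (\<Sum>j<m. v j * E1 (star (v j) * x))"
      proof (intro sum.cong refl)
        fix j assume "j \<in> {..<m}"
        then have j: "star (v j) * x \<in> A1" using x by (simp add: E1.A_closed E1.u_in)
        have "(\<Sum>i<n. (v j * u i) * E0 (E1 (star (v j * u i) * x)))
            = v j * (\<Sum>i<n. u i * E0 (star (u i) * E1 (star (v j) * x)))"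
          unfolding sum_distrib_left
          by (intro sum.cong refl) (simp add: star_mult mult.assoc E1.E_left j E0.A_closed E0.u_in)
        then show "(\<Sum>i<n. (v j * u i) * E0 (E1 (star (v j * u i) * x))) = v j * E1 (star (v j) * x)"
          by (simp add: E0.expand_left E1.E_in j)
      qed
      finally show "x = (\<Sum>l<m * n. w l * E0 (E1 (star (w l) * x)))"
        by (simp add: E1.expand_left x)
      have "(\<Sum>l<m * n. E0 (E1 (x * w l)) * star (w l))
          = (\<Sum>j<m. \<Sum>i<n. E0 (E1 (x * (v j * u i))) * star (v j * u i))"
        unfolding w_def by (rule sum_div_mod)
      also have "\<dots> = (\<Sum>j<m. E1 (x * v j) * star (v j))"
      proof (intro sum.cong refl)
        fix j assume "j \<in> {..<m}"
        then have j: "x * v j \<in> A1" using x by (simp add: E1.A_closed E1.u_in)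
        have "(\<Sum>i<n. E0 (E1 (x * (v j * u i))) * star (v j * u i))
            = (\<Sum>i<n. E0 (E1 (x * v j) * u i) * star (u i)) * star (v j)"
          unfolding sum_distrib_right
          by (intro sum.cong refl)
            (simp add: star_mult E1.E_right j E0.A_closed E0.u_in flip: mult.assoc)
        then show "(\<Sum>i<n. E0 (E1 (x * (v j * u i))) * star (v j * u i)) = E1 (x * v j) * star (v j)"
          by (simp add: E0.expand_right E1.E_in j)
      qed
      finally show "x = (\<Sum>l<m * n. E0 (E1 (x * w l)) * star (w l))"
        by (simp add: E1.expand_right x)
    qed
    have "(\<Sum>l<m * n. w l * star (w l)) = (\<Sum>j<m. \<Sum>i<n. v j * u i * star (v j * u i))"
      unfolding w_def by (rule sum_div_mod)
    also have "\<dots> = (\<Sum>j<m. v j * (\<Sum>i<n. u i * star (u i)) * star (v j))"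
      by (simp add: star_mult mult.assoc sum_distrib_left sum_distrib_right)
    also have "\<dots> = of_real r * (\<Sum>j<m. v j * star (v j))"
      by (simp add: E0.index sum_distrib_left mult.assoc of_real_commute[symmetric])
    finally show "(\<Sum>l<m * n. w l * star (w l)) = of_real (r * s)"
      by (simp add: E1.index)
  qed
  then show ?thesis by blast
qed

section \<open>The dual expectation on the basic construction\<close>

context expectation
begin

lemma adjoint_pair_sym:
  assumes "adjoint_pair A E S S'" "S \<in> module_maps B A" "S' \<in> module_maps B A"
  shows "adjoint_pair A E S' S"
  unfolding adjoint_pair_def module_inner_def
proof (intro ballI)
  fix x y assume x: "x \<in> A" and y: "y \<in> A"
  have in_A: "S y \<in> A" "S' x \<in> A" using assms(2,3) x y by (auto simp: module_maps_def)
  have "E (star (S' x) * y) = star (E (star y * S' x))"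
    using x y in_A by (simp add: star_mult star_star A_closed flip: E_star)
  also have "\<dots> = star (E (star (S y) * x))"
    using assms(1) x y by (simp add: adjoint_pair_def module_inner_def)
  also have "\<dots> = E (star x * S y)"
    using x y in_A by (simp add: star_mult star_star A_closed flip: E_star)
  finally show "E (star (S' x) * y) = E (star x * S y)" .
qed

lemma adjointable_operator_cstar_algebra:
  "operator_cstar_algebra B A E (adjointable_maps B A E)"
  unfolding operator_cstar_algebra_def
proof (intro conjI ballI allI impI)
  fix S T assume "S \<in> adjointable_maps B A E" "T \<in> adjointable_maps B A E"
  then obtain S' T' where S: "S \<in> module_maps B A" "S' \<in> module_maps B A" "adjoint_pair A E S S'"
    and T: "T \<in> module_maps B A" "T' \<in> module_maps B A" "adjoint_pair A E T T'"
    by (auto simp: adjointable_maps_def)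
  have in_A: "x \<in> A \<Longrightarrow> S x \<in> A" "x \<in> A \<Longrightarrow> S' x \<in> A" "x \<in> A \<Longrightarrow> T x \<in> A" "x \<in> A \<Longrightarrow> T' x \<in> A" for x
    using S T by (auto simp: module_maps_def)
  have "(\<lambda>x\<in>A. S x + T x) \<in> module_maps B A" "(\<lambda>x\<in>A. S' x + T' x) \<in> module_maps B A"
    using S T BA by (auto simp: module_maps_def in_A A_closed scaleC_add_right distrib_right subset_iff)
  moreover have "adjoint_pair A E (\<lambda>x\<in>A. S x + T x) (\<lambda>x\<in>A. S' x + T' x)"
    using S(3) T(3)
    by (simp add: adjoint_pair_def module_inner_def star_add distrib_left distrib_right E_add in_A A_closed)
  ultimately show "(\<lambda>x\<in>A. S x + T x) \<in> adjointable_maps B A E"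
    by (auto simp: adjointable_maps_def)
  have "compose A S T \<in> module_maps B A" "compose A T' S' \<in> module_maps B A"
    using S T BA by (auto simp: module_maps_def in_A A_closed subset_iff compose_def)
  moreover have "adjoint_pair A E (compose A S T) (compose A T' S')"
    using S(3) T(3) by (simp add: adjoint_pair_def module_inner_def in_A compose_def)
  ultimately show "compose A S T \<in> adjointable_maps B A E"
    by (auto simp: adjointable_maps_def)
next
  fix c T assume "T \<in> adjointable_maps B A E"
  then obtain T' where T: "T \<in> module_maps B A" "T' \<in> module_maps B A" "adjoint_pair A E T T'"
    by (auto simp: adjointable_maps_def)
  have in_A: "x \<in> A \<Longrightarrow> T x \<in> A" "x \<in> A \<Longrightarrow> T' x \<in> A" for x
    using T by (auto simp: module_maps_def)
  have "(\<lambda>x\<in>A. d *\<^sub>C S x) \<in> module_maps B A" if "S \<in> module_maps B A" for d S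
  proof -
    have "x \<in> A \<Longrightarrow> S x \<in> A" for x using that by (auto simp: module_maps_def)
    then show ?thesis using that BA
      by (auto simp: module_maps_def A_closed scaleC_add_right scaleC_scaleC mult.commute mult_scaleC_left subset_iff)
  qed
  moreover have "adjoint_pair A E (\<lambda>x\<in>A. c *\<^sub>C T x) (\<lambda>x\<in>A. cnj c *\<^sub>C T' x)"
    using T(3)
    by (simp add: adjoint_pair_def module_inner_def star_scaleC mult_scaleC_left mult_scaleC_right
        E_scaleC in_A A_closed)
  ultimately show "(\<lambda>x\<in>A. c *\<^sub>C T x) \<in> adjointable_maps B A E"
    using T by (auto simp: adjointable_maps_def)
next
  fix T T' assume "T \<in> adjointable_maps B A E" "T' \<in> module_maps B A" "adjoint_pair A E T T'"
  then show "T' \<in> adjointable_maps B A E"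
    using adjoint_pair_sym[of T T'] by (auto simp: adjointable_maps_def)
qed auto

lemma left_mult_adjointable: "a \<in> A \<Longrightarrow> left_mult A a \<in> adjointable_maps B A E"
proof -
  have "left_mult A b \<in> module_maps B A" if "b \<in> A" for b
    using that BA
    by (auto simp: left_mult_def module_maps_def A_closed distrib_left mult_scaleC_right mult.assoc subset_iff)
  moreover have "adjoint_pair A E (left_mult A a) (left_mult A (star a))"
    by (simp add: adjoint_pair_def module_inner_def left_mult_def star_mult mult.assoc)
  ultimately show "a \<in> A \<Longrightarrow> left_mult A a \<in> adjointable_maps B A E"
    using A_closed(8) by (auto simp: adjointable_maps_def)
qed

lemma jones_projection_adjointable: "jones_projection A E \<in> adjointable_maps B A E"
proof -
  have "jones_projection A E \<in> module_maps B A"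
    using BA by (auto simp: jones_projection_def module_maps_def A_closed E_add E_scaleC E_right subset_iff)
  moreover have "adjoint_pair A E (jones_projection A E) (jones_projection A E)"
    by (simp add: adjoint_pair_def module_inner_def jones_projection_def E_left E_right A_closed B_closed
        flip: E_star)
  ultimately show ?thesis by (auto simp: adjointable_maps_def)
qed

text \<open>The intersection defining the basic construction would be the whole type if its index family were
  empty; the algebra of all adjointable maps is a member.\<close>

lemma basic_construction_operators_subset:
  "basic_construction_operators B A E \<subseteq> adjointable_maps B A E"
  unfolding basic_construction_operators_def
  using adjointable_operator_cstar_algebra left_mult_adjointable jones_projection_adjointable by blast

lemma jones_projection_in: "jones_projection A E \<in> basic_construction_operators B A E"
  by (simp add: basic_construction_operators_def)

end

text \<open>A realization \<open>A1\<close> of the basic construction through its action \<open>op\<close> on the module \<open>A\<close>. By \<open>op_ext\<close>,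
  identities in \<open>A1\<close>, such as the Jones relations for \<open>e\<close>, can be checked on vectors.\<close>

locale basic_construction = scalar_index_expectation A B E n u r
  for A B :: "'a::cstar_algebra set" and E :: "'a \<Rightarrow> 'a" and n u r +
  fixes A1 :: "'a set" and op :: "'a \<Rightarrow> 'a \<Rightarrow> 'a" and e :: 'a
  assumes subalg_A1: "cstar_subalgebra A1" and AA1: "A \<subseteq> A1"
    and op_in: "x \<in> A1 \<Longrightarrow> z \<in> A \<Longrightarrow> op x z \<in> A"
    and op_add: "x \<in> A1 \<Longrightarrow> y \<in> A1 \<Longrightarrow> z \<in> A \<Longrightarrow> op (x + y) z = op x z + op y z"
    and op_mult: "x \<in> A1 \<Longrightarrow> y \<in> A1 \<Longrightarrow> z \<in> A \<Longrightarrow> op (x * y) z = op x (op y z)"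
    and op_scaleC: "x \<in> A1 \<Longrightarrow> z \<in> A \<Longrightarrow> op (c *\<^sub>C x) z = c *\<^sub>C op x z"
    and op_adjoint: "x \<in> A1 \<Longrightarrow> y \<in> A \<Longrightarrow> z \<in> A \<Longrightarrow> E (star (op x y) * z) = E (star y * op (star x) z)"
    and op_A: "a \<in> A \<Longrightarrow> z \<in> A \<Longrightarrow> op a z = a * z"
    and op_add_right: "x \<in> A1 \<Longrightarrow> y \<in> A \<Longrightarrow> z \<in> A \<Longrightarrow> op x (y + z) = op x y + op x z"
    and op_right: "x \<in> A1 \<Longrightarrow> z \<in> A \<Longrightarrow> b \<in> B \<Longrightarrow> op x (z * b) = op x z * b"
    and op_ext: "x \<in> A1 \<Longrightarrow> y \<in> A1 \<Longrightarrow> (\<And>z. z \<in> A \<Longrightarrow> op x z = op y z) \<Longrightarrow> x = y"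
    and e_in: "e \<in> A1" and op_e: "z \<in> A \<Longrightarrow> op e z = E z"

lemma is_basic_construction_realization:
  assumes "scalar_index_expectation A B E n u r" and bc: "is_basic_construction B A E A1"
  shows "\<exists>op e. basic_construction A B E n u r A1 op e"
proof -
  interpret scalar_index_expectation A B E n u r by fact
  obtain \<pi> where bij: "bij_betw \<pi> A1 (basic_construction_operators B A E)"
    and add: "\<And>x y. x \<in> A1 \<Longrightarrow> y \<in> A1 \<Longrightarrow> \<pi> (x + y) = (\<lambda>z\<in>A. \<pi> x z + \<pi> y z)"
    and mult: "\<And>x y. x \<in> A1 \<Longrightarrow> y \<in> A1 \<Longrightarrow> \<pi> (x * y) = compose A (\<pi> x) (\<pi> y)"
    and scale: "\<And>c x. x \<in> A1 \<Longrightarrow> \<pi> (c *\<^sub>C x) = (\<lambda>z\<in>A. c *\<^sub>C \<pi> x z)"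
    and adj: "\<And>x. x \<in> A1 \<Longrightarrow> adjoint_pair A E (\<pi> x) (\<pi> (star x))"
    and A: "\<And>a. a \<in> A \<Longrightarrow> \<pi> a = left_mult A a"
    and A1: "cstar_subalgebra A1" "A \<subseteq> A1"
    using bc unfolding is_basic_construction_def by blast
  have mm: "\<pi> x \<in> module_maps B A" if "x \<in> A1" for x
    using bij_betwE[OF bij] that basic_construction_operators_subset by (auto simp: adjointable_maps_def)
  obtain e where e: "e \<in> A1" "\<pi> e = jones_projection A E"
    using bij jones_projection_in by (metis bij_betw_def imageE)
  have "basic_construction A B E n u r A1 \<pi> e"
  proof unfold_locales
    fix x y assume xy: "x \<in> A1" "y \<in> A1" and eq: "\<And>z. z \<in> A \<Longrightarrow> \<pi> x z = \<pi> y z"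
    have "\<pi> x \<in> A \<rightarrow>\<^sub>E A" "\<pi> y \<in> A \<rightarrow>\<^sub>E A" using mm xy by (auto simp: module_maps_def)
    then have "\<pi> x = \<pi> y" using eq by (rule PiE_ext)
    then show "x = y" using bij xy by (auto simp: bij_betw_def inj_on_def)
  next
    fix x z assume "x \<in> A1" "z \<in> A"
    then show "\<pi> x z \<in> A" using mm[of x] by (auto simp: module_maps_def)
  next
    fix x y z assume "x \<in> A1" "y \<in> A" "z \<in> A"
    then show "E (star (\<pi> x y) * z) = E (star y * \<pi> (star x) z)"
      using adj by (simp add: adjoint_pair_def module_inner_def)
  qed (use mm A1 e in \<open>auto simp: add mult scale A module_maps_def compose_def left_mult_def jones_projection_def\<close>)
  then show ?thesis by blast
qed

context basic_construction
begin

lemmas A1_closed = subalg_1[OF subalg_A1] subalg_0[OF subalg_A1] subalg_add[OF subalg_A1]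
  subalg_diff[OF subalg_A1] subalg_mult[OF subalg_A1] subalg_scaleC[OF subalg_A1]
  subalg_scaleR[OF subalg_A1] subalg_star[OF subalg_A1] subalg_sum[OF subalg_A1] subalg_of_real[OF subalg_A1]

lemma A1_I: "a \<in> A \<Longrightarrow> a \<in> A1" using AA1 by blast

lemma A_B: "b \<in> B \<Longrightarrow> b \<in> A" using BA by blast

lemma op_0: "z \<in> A \<Longrightarrow> op 0 z = 0" by (simp add: op_A A_closed)

lemma op_0_right: "x \<in> A1 \<Longrightarrow> op x 0 = 0"
  using op_right[of x 0 0] by (simp add: A_closed B_closed)

lemma op_sum: "(\<And>i. i \<in> I \<Longrightarrow> f i \<in> A1) \<Longrightarrow> z \<in> A \<Longrightarrow> op (sum f I) z = (\<Sum>i\<in>I. op (f i) z)"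
  by (induction I rule: infinite_finite_induct) (simp_all add: op_0 op_add A1_closed)

lemma op_sum_right: "x \<in> A1 \<Longrightarrow> (\<And>i. i \<in> I \<Longrightarrow> f i \<in> A) \<Longrightarrow> op x (sum f I) = (\<Sum>i\<in>I. op x (f i))"
  by (induction I rule: infinite_finite_induct) (simp_all add: op_0_right op_add_right A_closed)

lemma op_expand: "x \<in> A1 \<Longrightarrow> z \<in> A \<Longrightarrow> (\<Sum>i<n. op x (u i) * E (star (u i) * z)) = op x z"
proof -
  assume x: "x \<in> A1" and z: "z \<in> A"
  have "op x z = op x (\<Sum>i<n. u i * E (star (u i) * z))" by (simp add: expand_left z)
  also have "\<dots> = (\<Sum>i<n. op x (u i * E (star (u i) * z)))"
    by (rule op_sum_right) (simp_all add: x z A_closed u_in)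
  also have "\<dots> = (\<Sum>i<n. op x (u i) * E (star (u i) * z))"
    by (rule sum.cong) (simp_all add: op_right x z B_closed A_closed u_in)
  finally show ?thesis by simp
qed

lemma e_commute: "b \<in> B \<Longrightarrow> e * b = b * e"
  by (rule op_ext) (simp_all add: op_mult op_A op_e E_left A1_closed A1_I A_B e_in A_closed)

lemma e_compress: "a \<in> A \<Longrightarrow> e * a * e = E a * e"
  by (rule op_ext) (simp_all add: op_mult op_A op_e E_right A1_closed A1_I A_B e_in A_closed B_closed)

lemma e_idem: "e * e = e"
  using e_compress[of 1] by (simp add: A_closed B_closed E_id)

lemma e_star: "star e = e"
proof (rule op_ext)
  fix z assume z: "z \<in> A"
  define y where "y = op (star e) z - E z"
  have yA: "y \<in> A" "op (star e) z \<in> A" by (simp_all add: y_def op_in A1_closed e_in A_closed z)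
  have "E (star y * op (star e) z) = E (star (E y) * z)"
    using op_adjoint[OF e_in yA(1) z] by (simp add: op_e yA)
  also have "\<dots> = E (star y * E z)"
    using yA z by (simp add: E_left E_right A_closed B_closed flip: E_star)
  finally have "E (star y * y) = 0"
    using yA z by (subst (2) y_def) (simp add: right_diff_distrib E_diff A_closed)
  then have "y = 0" by (rule E_faithful[OF yA(1)])
  then show "op (star e) z = op e z" by (simp add: y_def op_e z)
qed (simp_all add: A1_closed e_in)

text \<open>The quasi-basis identity \<open>\<Sum>k. u k * e * star (u k) = 1\<close>, multiplied by \<open>x\<close> from the left.\<close>

lemma A1_expand: "x \<in> A1 \<Longrightarrow> (\<Sum>k<n. op x (u k) * e * star (u k)) = x"
proof (rule op_ext)
  fix z assume x: "x \<in> A1" and z: "z \<in> A"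
  have "op (\<Sum>k<n. op x (u k) * e * star (u k)) z = (\<Sum>k<n. op (op x (u k) * e * star (u k)) z)"
    by (rule op_sum) (simp_all add: A1_closed A1_I op_in x z e_in u_in)
  also have "\<dots> = (\<Sum>k<n. op x (u k) * E (star (u k) * z))"
    by (rule sum.cong) (simp_all add: op_mult op_A op_e A1_closed A1_I op_in x z e_in u_in A_closed)
  finally show "op (\<Sum>k<n. op x (u k) * e * star (u k)) z = op x z"
    by (simp add: op_expand x z)
next
  assume x: "x \<in> A1"
  show "(\<Sum>k<n. op x (u k) * e * star (u k)) \<in> A1"
    by (intro A1_closed A1_I[OF op_in] A1_I[OF u_in] e_in u_in x) simp_all
qed

text \<open>The formula is forced by \<open>A1_expand\<close>: it is the linear map with \<open>a * e * b \<mapsto> (1 / r) * (a * b)\<close>.\<close>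

definition dual_exp :: "'a \<Rightarrow> 'a" where
  "dual_exp x = (1 / r) *\<^sub>R (\<Sum>i<n. op x (u i) * star (u i))"

lemma r_pos: "r > 0" using index_ge_1 by simp

lemma dual_in: "x \<in> A1 \<Longrightarrow> dual_exp x \<in> A"
  unfolding dual_exp_def by (intro A_closed op_in u_in) simp_all

lemma dual_id: "a \<in> A \<Longrightarrow> dual_exp a = a"
proof -
  assume a: "a \<in> A"
  have "(\<Sum>i<n. op a (u i) * star (u i)) = a * (\<Sum>i<n. u i * star (u i))"
    by (simp add: op_A a u_in sum_distrib_left mult.assoc)
  then show ?thesis using r_pos by (simp add: dual_exp_def index of_real_def)
qed

lemma dual_add: "x \<in> A1 \<Longrightarrow> y \<in> A1 \<Longrightarrow> dual_exp (x + y) = dual_exp x + dual_exp y"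
  by (simp add: dual_exp_def op_add u_in distrib_right sum.distrib scaleR_add_right)

lemma dual_scaleC: "x \<in> A1 \<Longrightarrow> dual_exp (c *\<^sub>C x) = c *\<^sub>C dual_exp x"
  by (simp add: dual_exp_def op_scaleC u_in mult_scaleC_left scaleR_scaleC scaleC_scaleC mult.commute
      flip: complex_vs.scale_sum_right)

lemma dual_scaleR: "x \<in> A1 \<Longrightarrow> dual_exp (c *\<^sub>R x) = c *\<^sub>R dual_exp x"
  by (simp add: scaleR_scaleC dual_scaleC)

lemma dual_diff: "x \<in> A1 \<Longrightarrow> y \<in> A1 \<Longrightarrow> dual_exp (x - y) = dual_exp x - dual_exp y"
  using dual_add[of x "(-1) *\<^sub>R y"] dual_scaleR[of y "-1"] by (simp add: subalg_uminus[OF subalg_A1])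

lemma dual_sum: "(\<And>i. i \<in> I \<Longrightarrow> f i \<in> A1) \<Longrightarrow> dual_exp (sum f I) = (\<Sum>i\<in>I. dual_exp (f i))"
  by (induction I rule: infinite_finite_induct) (simp_all add: dual_add A1_closed dual_id A_closed)

lemma dual_left: "a \<in> A \<Longrightarrow> x \<in> A1 \<Longrightarrow> dual_exp (a * x) = a * dual_exp x"
  by (simp add: dual_exp_def op_mult op_A A1_I u_in op_in sum_distrib_left mult.assoc)

lemma op_star_expand:
  assumes "x \<in> A1" "z \<in> A"
  shows "op (star x) z = (\<Sum>j<n. u j * E (star (op x (u j)) * z))"
proof -
  have "op (star x) z = (\<Sum>j<n. u j * E (star (u j) * op (star x) z))"
    by (simp add: expand_left op_in A1_closed assms)
  then show ?thesis by (simp add: op_adjoint u_in assms)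
qed

lemma dual_star: "x \<in> A1 \<Longrightarrow> dual_exp (star x) = star (dual_exp x)"
proof -
  assume x: "x \<in> A1"
  have "(\<Sum>i<n. op (star x) (u i) * star (u i))
      = (\<Sum>i<n. \<Sum>j<n. u j * (E (star (op x (u j)) * u i) * star (u i)))"
    by (simp add: op_star_expand x u_in sum_distrib_right mult.assoc)
  also have "\<dots> = (\<Sum>j<n. u j * (\<Sum>i<n. E (star (op x (u j)) * u i) * star (u i)))"
    unfolding sum_distrib_left by (rule sum.swap)
  also have "\<dots> = (\<Sum>j<n. u j * star (op x (u j)))"
    by (simp add: expand_right A_closed op_in x u_in)
  finally show ?thesis by (simp add: dual_exp_def star_scaleR star_sum star_mult star_star)
qed

lemma dual_right: "a \<in> A \<Longrightarrow> x \<in> A1 \<Longrightarrow> dual_exp (x * a) = dual_exp x * a"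
proof -
  assume a: "a \<in> A" and x: "x \<in> A1"
  have "star (dual_exp (x * a)) = star (dual_exp x * a)"
    by (simp add: star_mult dual_left A1_closed A_closed A1_I a x flip: dual_star)
  then show ?thesis by (metis star_star)
qed

text \<open>Complete positivity of \<open>E\<close> again, for the Gram matrix of the vectors \<open>op y (u j)\<close>.\<close>

lemma dual_square: "y \<in> A1 \<Longrightarrow> cpos (dual_exp (star y * y))"
proof -
  assume y: "y \<in> A1"
  have "(\<Sum>i<n. op (star y * y) (u i) * star (u i))
      = (\<Sum>i<n. \<Sum>j<n. u j * E (star (op y (u j)) * op y (u i)) * star (u i))"
    by (intro sum.cong refl) (simp add: op_mult op_star_expand y u_in op_in A1_closed sum_distrib_right)
  also have "\<dots> = (\<Sum>j<n. \<Sum>i<n. u j * E (star (op y (u j)) * op y (u i)) * star (u i))"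
    by (rule sum.swap)
  also have "cpos \<dots>"
    by (rule cpos_gram) (simp add: op_in y u_in)
  finally show ?thesis using r_pos by (simp add: dual_exp_def cpos_scaleR)
qed

lemma dual_cpos: "x \<in> A1 \<Longrightarrow> cpos x \<Longrightarrow> cpos (dual_exp x)"
  using positive_in_iff[OF subalg_A1] dual_square unfolding positive_in_def by metis

text \<open>The Kadison-Schwarz inequality \<open>star (P x) * P x \<le> P (star x * x) \<le> \<parallel>x\<parallel>\<^sup>2\<close> for the dual expectation
  \<open>P\<close>; the first step is the positivity of \<open>P\<close> on \<open>star (x - P x) * (x - P x)\<close>.\<close>

lemma dual_norm: "x \<in> A1 \<Longrightarrow> norm (dual_exp x) \<le> norm x"
proof -
  assume x: "x \<in> A1"
  have xx: "star x * x \<in> A1" by (simp add: A1_closed x)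
  have Dx: "dual_exp x \<in> A" "dual_exp x \<in> A1" by (simp_all add: dual_in x A1_I)
  have "dual_exp (star (x - dual_exp x) * (x - dual_exp x)) = dual_exp (star x * x) - star (dual_exp x) * dual_exp x"
    by (simp add: star_diff left_diff_distrib right_diff_distrib dual_diff dual_left dual_right dual_id dual_star
        A1_closed A_closed x Dx)
  then have "cpos (dual_exp (star x * x) - star (dual_exp x) * dual_exp x)"
    using dual_square[of "x - dual_exp x"] x Dx by (simp add: A1_closed)
  then have "norm (star (dual_exp x) * dual_exp x) \<le> norm (dual_exp (star x * x))"
    by (intro norm_mono_positive cpos_star_mult_self)
  also have "\<dots> \<le> (norm x)\<^sup>2"
  proof (rule norm_le_of_positive_diff)
    show "cpos (dual_exp (star x * x))" by (rule dual_square[OF x])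
    have "cpos (of_real ((norm x)\<^sup>2) - star x * x)"
      by (intro cpos_norm_minus cpos_star_mult_self) (simp add: cstar_identity)
    then have "cpos (dual_exp (of_real ((norm x)\<^sup>2) - star x * x))"
      by (intro dual_cpos) (simp_all only: A1_closed xx)
    then show "cpos (of_real ((norm x)\<^sup>2) - dual_exp (star x * x))"
      by (simp add: dual_diff dual_id A1_closed A_closed xx x del: of_real_power)
  qed simp
  finally show ?thesis by (simp add: cstar_identity)
qed

lemma dual_conditional_expectation: "conditional_expectation A1 A dual_exp"
  unfolding conditional_expectation_def positive_in_iff[OF subalg_A1] positive_in_iff[OF subalg_A]
  by (auto simp: dual_in dual_id dual_add dual_scaleC dual_cpos dual_norm dual_left dual_right A1_closed A1_I)

lemma dual_aeb: "a \<in> A \<Longrightarrow> b \<in> A \<Longrightarrow> dual_exp (a * e * b) = (1 / r) *\<^sub>R (a * b)"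
proof -
  assume a: "a \<in> A" and b: "b \<in> A"
  have "(\<Sum>i<n. op (a * e * b) (u i) * star (u i)) = (\<Sum>i<n. a * (E (b * u i) * star (u i)))"
    by (rule sum.cong) (simp_all add: op_mult op_A op_e A1_closed A1_I e_in a b u_in A_closed mult.assoc)
  also have "\<dots> = a * b" by (simp add: expand_right b flip: sum_distrib_left)
  finally show ?thesis by (simp add: dual_exp_def)
qed

text \<open>The factor \<open>sqrt r\<close> compensates the \<open>1 / r\<close> in the dual expectation, and it makes the index
  \<open>r\<close> times \<open>\<Sum>i. u i * e * star (u i) = 1\<close>.\<close>

definition dual_basis :: "nat \<Rightarrow> 'a" where
  "dual_basis i = sqrt r *\<^sub>R (u i * e)"

lemma dual_basis_in: "i < n \<Longrightarrow> dual_basis i \<in> A1"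
  by (simp add: dual_basis_def A1_closed A1_I u_in e_in)

text \<open>Insert the expansion of \<open>x\<close>, compress \<open>e * a * e = E a * e\<close>, and move \<open>e\<close> past the resulting element
  of \<open>B\<close>: what is left of the sum over \<open>i\<close> is the expansion of \<open>op x (u k)\<close> in the quasi-basis of \<open>A\<close>.\<close>

lemma dual_basis_expand: "x \<in> A1 \<Longrightarrow> (\<Sum>i<n. dual_basis i * dual_exp (star (dual_basis i) * x)) = x"
proof -
  assume x: "x \<in> A1"
  have summand: "dual_basis i * dual_exp (star (dual_basis i) * x)
      = (\<Sum>k<n. u i * E (star (u i) * op x (u k)) * (e * star (u k)))" if i: "i < n" for i
  proof -
    have "e * star (u i) * x = e * star (u i) * (\<Sum>k<n. op x (u k) * e * star (u k))"
      by (simp add: A1_expand x)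
    also have "\<dots> = (\<Sum>k<n. E (star (u i) * op x (u k)) * e * star (u k))"
      unfolding sum_distrib_left
    proof (intro sum.cong refl)
      fix k assume "k \<in> {..<n}"
      then have "e * (star (u i) * op x (u k)) * e = E (star (u i) * op x (u k)) * e"
        using i x by (intro e_compress) (simp add: A_closed u_in op_in)
      then show "e * star (u i) * (op x (u k) * e * star (u k)) = E (star (u i) * op x (u k)) * e * star (u k)"
        by (metis mult.assoc)
    qed
    finally have "dual_exp (e * star (u i) * x) = (\<Sum>k<n. dual_exp (E (star (u i) * op x (u k)) * e * star (u k)))"
      using i x by (simp only:) (rule dual_sum, simp add: A1_closed A1_I A_closed e_in op_in u_in)
    also have "\<dots> = (\<Sum>k<n. (1 / r) *\<^sub>R (E (star (u i) * op x (u k)) * star (u k)))"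
      using i x by (intro sum.cong refl dual_aeb) (simp_all add: A_closed op_in u_in)
    finally have dual_summand: "dual_exp (e * star (u i) * x) = (1 / r) *\<^sub>R (\<Sum>k<n. E (star (u i) * op x (u k)) * star (u k))"
      by (simp add: scaleR_sum_right)
    have "star (dual_basis i) * x = sqrt r *\<^sub>R (e * star (u i) * x)"
      by (simp add: dual_basis_def star_scaleR star_mult e_star)
    then have "dual_exp (star (dual_basis i) * x) = sqrt r *\<^sub>R dual_exp (e * star (u i) * x)"
      using i x by (simp add: dual_scaleR A1_closed A1_I A_closed e_in u_in)
    then have "dual_basis i * dual_exp (star (dual_basis i) * x)
        = u i * e * (\<Sum>k<n. E (star (u i) * op x (u k)) * star (u k))"
      using r_pos by (simp add: dual_summand dual_basis_def)
    also have "\<dots> = (\<Sum>k<n. u i * E (star (u i) * op x (u k)) * (e * star (u k)))"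
      unfolding sum_distrib_left
    proof (intro sum.cong refl)
      fix k assume "k \<in> {..<n}"
      then have "e * E (star (u i) * op x (u k)) = E (star (u i) * op x (u k)) * e"
        using i x by (intro e_commute) (simp add: A_closed B_closed u_in op_in)
      then show "u i * e * (E (star (u i) * op x (u k)) * star (u k))
          = u i * E (star (u i) * op x (u k)) * (e * star (u k))"
        by (metis mult.assoc)
    qed
    finally show ?thesis .
  qed
  have "(\<Sum>i<n. dual_basis i * dual_exp (star (dual_basis i) * x))
      = (\<Sum>i<n. \<Sum>k<n. u i * E (star (u i) * op x (u k)) * (e * star (u k)))"
    by (simp add: summand)
  also have "\<dots> = (\<Sum>k<n. (\<Sum>i<n. u i * E (star (u i) * op x (u k))) * (e * star (u k)))"
    unfolding sum_distrib_right by (rule sum.swap)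
  also have "\<dots> = (\<Sum>k<n. op x (u k) * e * star (u k))"
    by (simp add: expand_left op_in x u_in mult.assoc)
  finally show ?thesis by (simp add: A1_expand x)
qed

lemma dual_quasi_basis: "quasi_basis A1 dual_exp n dual_basis"
  unfolding quasi_basis_def
proof (intro conjI allI impI ballI)
  fix x assume x: "x \<in> A1"
  show "x = (\<Sum>i<n. dual_basis i * dual_exp (star (dual_basis i) * x))"
    by (simp add: dual_basis_expand x)
  have "star x = (\<Sum>i<n. dual_basis i * dual_exp (star (dual_basis i) * star x))"
    by (simp add: dual_basis_expand x A1_closed)
  from arg_cong[OF this, of star]
  show "x = (\<Sum>i<n. dual_exp (x * dual_basis i) * star (dual_basis i))"
    by (simp add: star_sum star_mult star_star A1_closed x dual_basis_in flip: dual_star)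
qed (rule dual_basis_in)

lemma dual_index: "(\<Sum>i<n. dual_basis i * star (dual_basis i)) = of_real r"
proof -
  have "(\<Sum>i<n. dual_basis i * star (dual_basis i)) = (\<Sum>i<n. r *\<^sub>R (u i * e * star (u i)))"
    using r_pos by (intro sum.cong refl)
      (simp add: dual_basis_def star_scaleR star_mult e_star, metis e_idem mult.assoc)
  also have "\<dots> = r *\<^sub>R (\<Sum>i<n. op 1 (u i) * e * star (u i))"
    by (simp add: op_A A_closed u_in scaleR_sum_right)
  finally show ?thesis by (simp add: A1_expand A1_closed of_real_def)
qed

lemma dual_expectation: "scalar_index_expectation A1 A dual_exp n dual_basis r"
  by unfold_locales (fact subalg_A1 subalg_A AA1 dual_conditional_expectation dual_quasi_basis dual_index)+

end

section \<open>The tower\<close>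

lemma minimal_expectation_scalar:
  assumes "cstar_subalgebra A" "cstar_subalgebra B" "B \<subseteq> A" and min: "minimal_expectation A B E"
  shows "\<exists>n u r. scalar_index_expectation A B E n u r \<and>
    (\<forall>F s. finite_index_expectation A B F \<and> Ind A F = of_real s \<longrightarrow> r \<le> s)"
proof -
  obtain n u r where ce: "conditional_expectation A B E" and qb: "quasi_basis A E n u"
    and r: "Ind A E = of_real r" "\<forall>F s. finite_index_expectation A B F \<and> Ind A F = of_real s \<longrightarrow> r \<le> s"
    using min by (auto simp: minimal_expectation_def finite_index_expectation_def)
  interpret based_expectation A B E n u by unfold_locales (fact assms(1-3) ce qb)+
  have "scalar_index_expectation A B E n u r"
    by unfold_locales (simp add: r flip: Ind_eq)
  with r(2) show ?thesis by blast
qed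

lemma (in scalar_index_expectation) finite_index: "finite_index_expectation A B E"
  using cond_exp basis by (auto simp: finite_index_expectation_def)

lemma minimal_index_eq:
  assumes min: "minimal_expectation A B E" and r: "Ind A E = of_real r"
  shows "minimal_index A B = r"
  unfolding minimal_index_def
proof (rule the_equality)
  show "\<exists>E. minimal_expectation A B E \<and> Ind A E = of_real r" using assms by blast
  fix s assume "\<exists>E. minimal_expectation A B E \<and> Ind A E = of_real s"
  then obtain F where F: "minimal_expectation A B F" "Ind A F = of_real s" by blast
  have le: "a \<le> b" if "minimal_expectation A B G" "minimal_expectation A B H"
    "Ind A G = of_real a" "Ind A H = of_real b" for G H a b
    using that unfolding minimal_expectation_def by (metis of_real_eq_iff)
  show "s = r" using le[OF F(1) min F(2) r] le[OF min F(1) r F(2)] by simp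
qed

theorem proposition2p26:
  fixes B A :: "'a::cstar_algebra set" and T :: "nat \<Rightarrow> 'a set"
  assumes "simple_cstar B" and "simple_cstar A" and "B \<subseteq> A"
    and "\<exists>E. finite_index_expectation A B E"
    and "basic_construction_tower B A T"
  shows "\<forall>k. finite_dimC (relative_commutant B (T k)) \<and>
             real (complex_vs.dim (relative_commutant B (T k))) \<le> minimal_index A B ^ (k + 1)"
proof -
  obtain E where T0: "T 0 = A" and min: "\<And>k. minimal_expectation (T k) (below B T k) (E k)"
    and bc: "\<And>k. is_basic_construction (below B T k) (T k) (E k) (T (Suc k))"
    using assms(5) unfolding basic_construction_tower_def by blast
  have subB: "cstar_subalgebra B" and subA: "cstar_subalgebra A"
    using assms(1,2) by (simp_all add: simple_cstar_def)
  have subT: "cstar_subalgebra (T k)" for k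
    using bc subA T0 by (cases k) (auto simp: is_basic_construction_def)
  have sub_below: "cstar_subalgebra (below B T k)" for k
    using subB subT by (cases k) (auto simp: below_def)
  have below_T: "below B T k \<subseteq> T k" for k
    using bc assms(3) T0 by (cases k) (auto simp: below_def is_basic_construction_def)
  have "\<exists>n u r. scalar_index_expectation (T k) (below B T k) (E k) n u r \<and>
    (\<forall>F s. finite_index_expectation (T k) (below B T k) F \<and> Ind (T k) F = of_real s \<longrightarrow> r \<le> s)" for k
    by (rule minimal_expectation_scalar[OF subT sub_below below_T min])
  then obtain n u r where E: "\<And>k. scalar_index_expectation (T k) (below B T k) (E k) (n k) (u k) (r k)"
    and least: "\<And>k F s. finite_index_expectation (T k) (below B T k) F \<Longrightarrow> Ind (T k) F = of_real s \<Longrightarrow> r k \<le> s"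
    by metis
  \<comment> \<open>The dual expectation has the index of the previous level and competes with \<open>E (Suc k)\<close>.\<close>
  have step: "r (Suc k) \<le> r k" for k
  proof -
    obtain op e where "basic_construction (T k) (below B T k) (E k) (n k) (u k) (r k) (T (Suc k)) op e"
      using is_basic_construction_realization[OF E bc] by blast
    then interpret bc: basic_construction "T k" "below B T k" "E k" "n k" "u k" "r k" "T (Suc k)" op e .
    interpret dual: scalar_index_expectation "T (Suc k)" "T k" bc.dual_exp "n k" bc.dual_basis "r k"
      by (rule bc.dual_expectation)
    show ?thesis
      using least[of "Suc k" bc.dual_exp "r k"] dual.finite_index dual.Ind_scalar by (simp add: below_def)
  qed
  have le: "r k \<le> r 0" for k
    by (induction k) (use step order_trans in auto)
  have ge1: "1 \<le> r k" for k
    by (rule scalar_index_expectation.index_ge_1[OF E])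
  have min0: "minimal_index A B = r 0"
    using minimal_index_eq[OF min[of 0]] scalar_index_expectation.Ind_scalar[OF E[of 0]]
    by (simp add: T0 below_def)
  have comp: "\<exists>F m w s. scalar_index_expectation (T k) B F m w s \<and> s \<le> r 0 ^ (k + 1)" for k
  proof (induction k)
    case 0
    then show ?case using E[of 0] by (auto simp: below_def)
  next
    case (Suc k)
    then obtain F m w s where F: "scalar_index_expectation (T k) B F m w s" "s \<le> r 0 ^ (k + 1)" by blast
    have "scalar_index_expectation (T (Suc k)) (T k) (E (Suc k)) (n (Suc k)) (u (Suc k)) (r (Suc k))"
      using E[of "Suc k"] by (simp add: below_def)
    from index_compose[OF this F(1)] obtain w' where
      "scalar_index_expectation (T (Suc k)) B (\<lambda>x. F (E (Suc k) x)) (n (Suc k) * m) w' (s * r (Suc k))" by blast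
    moreover have "s * r (Suc k) \<le> r 0 ^ (k + 1) * r 0"
      using F(2) le[of "Suc k"] ge1[of "Suc k"] ge1[of 0] by (intro mult_mono) simp_all
    ultimately show ?case by (auto simp: mult.commute)
  qed
  show ?thesis
  proof (intro allI)
    fix k
    obtain F m w s where F: "scalar_index_expectation (T k) B F m w s" "s \<le> r 0 ^ (k + 1)"
      using comp by blast
    interpret simple_index "T k" B F m w s
      by (intro simple_index.intro F(1) simple_index_axioms.intro assms(1))
    show "finite_dimC (relative_commutant B (T k)) \<and>
        real (complex_vs.dim (relative_commutant B (T k))) \<le> minimal_index A B ^ (k + 1)"
      using dim_relative_commutant_le F(2) unfolding min0 by linarith
  qed
qed

end
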